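(* Let $\alpha\in(0,1)$ and let $T=h(W,\boldsymbol Y)$ be the loss model described in the context, with $W$ discrete, and let $T_{W,\varepsilon}$ be the loss stressed via a stress function $\kappa_\varepsilon$ applied to the uniform variable $U$ generating $W$. Let $F_\varepsilon$ be the distribution function of $T_{W,\varepsilon}$, $F=F_0$ that of $T$, and assume that for all $\varepsilon$ in a neighbourhood of $0$, $F_\varepsilon$ is continuously differentiable at $F^{-1}(\alpha)$, and that $q_\alpha(\varepsilon)=F_\varepsilon^{-1}(\alpha)$ is differentiable with respect to $\varepsilon$. Let $q_\alpha=F^{-1}(\alpha)$ be the $\alpha$-quantile of $T$ and $f$ the density of $T$. Then the sensitivity for VaR to the discrete input $W$ is $$\tilde{\mathcal S}_W[\mathrm{VaR}_\alpha]=\frac{c(\kappa)}{f(q_\alpha)}\sum_{k=1}^r\mathfrak K^{-1}(p_k)\,\mathbb E\left[\mathbf 1_{\{T\le q_\alpha+c(\kappa)\Delta_k h(W,\boldsymbol Y)\}}-\mathbf 1_{\{T\le q_\alpha\}}\;\middle|\;W=w_k\right],$$ and the sensitivity for ES to the discrete input $W$ is $$\tilde{\mathcal S}_W[\mathrm{ES}_\alpha]=-\frac{c(\kappa)}{1-\alpha}\sum_{k=1}^r\mathfrak K^{-1}(p_k)\,\mathbb E\left[\big(T-c(\kappa)\Delta_k h(W,\boldsymbol Y)-q_\alpha\big)_+-(T-q_\alpha)_+\;\middle|\;W=w_k\right].$$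
   Context: Model. On a probability space, $\boldsymbol Y=(Y_1,\dots,Y_d)$ is a random vector, $h:\mathbb R^{d+1}\to\mathbb R$ is differentiable, and $W$ is a discrete random variable with values $w_1<\dots<w_r$ and $\mathbb P(W\le w_k)=p_k$, $k=1,\dots,r$, where $0=:p_0<p_1<\dots<p_r=1$. The loss is $T=h(W,\boldsymbol Y)$. Let $V\sim\mathrm U(0,1)$ be independent of $(W,\boldsymbol Y)$ and $U:=\tilde F_W(W;V)$ with $\tilde F_W(w;\lambda)=\mathbb P(W<w)+\lambda\,\mathbb P(W=w)$, $\lambda\in[0,1]$. Then $U\sim\mathrm U(0,1)$, $W=\sum_{k=1}^rw_k\mathbf 1_{\{p_{k-1}<U\le p_k\}}$ a.s., and $T=\sum_{k=1}^r\Delta_kh(W,\boldsymbol Y)\mathbf 1_{\{U\le p_k\}}$, where $\Delta_kh(W,\boldsymbol Y):=h(w_k,\boldsymbol Y)-h(w_{k+1},\boldsymbol Y)$ for $k=1,\dots,r-1$ and $\Delta_rh(W,\boldsymbol Y):=h(w_r,\boldsymbol Y)$. Stress functions. A family $\kappa_\varepsilon:A\to A$, $A\subseteq\mathbb R$, $\varepsilon\in[0,\infty)$, is a stress function if: (i) for all $\varepsilon$ in a neighbourhood of $0$, $\kappa_\varepsilon$ is invertible on $A$ with inverse $\kappa_\varepsilon^{-1}$; (ii) $\lim_{\varepsilon\searrow0}\kappa_\varepsilon(x)=x$ for all $x\in A$; (iii) $\lim_{\varepsilon\searrow0}\kappa^{-1}_\varepsilon(x)=x$ for all $x\in A$; (iv)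 either (a) $\kappa_\varepsilon(x)\ge x$ for all $\varepsilon$ in a neighbourhood of $0$ and all $x\in A$, or (b) $\kappa_\varepsilon(x)\le x$ for all $\varepsilon$ in a neighbourhood of $0$ and all $x\in A$; (v) $\mathfrak K(x):=\lim_{\varepsilon\to0}\frac{\kappa_\varepsilon(x)-x}{\varepsilon}$ exists for $x\in A$; (vi) $\mathfrak K^{-1}(x):=\lim_{\varepsilon\to0}\frac{\kappa^{-1}_\varepsilon(x)-x}{\varepsilon}$ exists for $x\in A$ (here $\mathfrak K^{-1}$ is just notation, not an inverse of $\mathfrak K$). Put $c(\kappa)=+1$ in case (a) and $c(\kappa)=-1$ in case (b). When stressing a random variable (here $U$), the domain $A$ is typically its support. Stressed loss and sensitivity. $T_{W,\varepsilon}:=\sum_{k=1}^r\Delta_kh(W,\boldsymbol Y)\mathbf 1_{\{\kappa_\varepsilon(U)\le p_k\}}$. For a risk measure $\rho$, $\tilde{\mathcal S}_W[\rho]:=\frac{\partial}{\partial\varepsilon}\rho(T_{W,\varepsilon})\big|_{\varepsilon=0}$ (with $\varepsilon\in[0,\infty)$). For a random variable with distribution function $F$: $\mathrm{VaR}_\alpha=F^{-1}(\alpha)=\inf\{y\in\mathbb R:F(y)\ge\alpha\}$ and $\mathrm{ES}_\alpha=\frac1{1-\alpha}\int_\alpha^1F^{-1}(u)\,du$. Notation: $x_+=\max\{x,0\}$.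
   Formalization: The printed claim fails in general: when c(κ)=−1 the conditioning event is W=w_{k+1} instead of W=w_k (k<r), and κ_ε is assumed nondecreasing on A=[0,1], the support of U, for ε near 0; f(q_α)≠0 (VaR) and finite ES near ε=0 (ES) are made explicit. *)

theory Defs
  imports "HOL-Probability.Probability"
begin

text \<open>Neighbourhoods of \<open>0\<close> are taken in the parameter space \<open>[0,\<infinity>)\<close>, so they contain \<open>0\<close> itself.\<close>

definition near_zero :: "(real \<Rightarrow> bool) \<Rightarrow> bool" where
  "near_zero P \<longleftrightarrow> (\<exists>\<delta>>0. \<forall>\<epsilon>\<in>{0..<\<delta>}. P \<epsilon>)"

definition stress_up :: "real set \<Rightarrow> (real \<Rightarrow> real \<Rightarrow> real) \<Rightarrow> bool" where
  "stress_up A \<kappa> \<longleftrightarrow> near_zero (\<lambda>\<epsilon>. \<forall>x\<in>A. x \<le> \<kappa> \<epsilon> x)"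

definition stress_down :: "real set \<Rightarrow> (real \<Rightarrow> real \<Rightarrow> real) \<Rightarrow> bool" where
  "stress_down A \<kappa> \<longleftrightarrow> near_zero (\<lambda>\<epsilon>. \<forall>x\<in>A. \<kappa> \<epsilon> x \<le> x)"

definition stress_function :: "real set \<Rightarrow> (real \<Rightarrow> real \<Rightarrow> real) \<Rightarrow> bool" where
  "stress_function A \<kappa> \<longleftrightarrow>
     (\<forall>\<epsilon>\<ge>0. \<kappa> \<epsilon> ` A \<subseteq> A) \<and>
     near_zero (\<lambda>\<epsilon>. bij_betw (\<kappa> \<epsilon>) A A) \<and>
     (\<forall>x\<in>A. ((\<lambda>\<epsilon>. \<kappa> \<epsilon> x) \<longlongrightarrow> x) (at_right 0)) \<and>
     (\<forall>x\<in>A. ((\<lambda>\<epsilon>. inv_into A (\<kappa> \<epsilon>) x) \<longlongrightarrow> x) (at_right 0)) \<and>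
     (stress_up A \<kappa> \<or> stress_down A \<kappa>) \<and>
     (\<forall>x\<in>A. \<exists>l. ((\<lambda>\<epsilon>. (\<kappa> \<epsilon> x - x) / \<epsilon>) \<longlongrightarrow> l) (at_right 0)) \<and>
     (\<forall>x\<in>A. \<exists>l. ((\<lambda>\<epsilon>. (inv_into A (\<kappa> \<epsilon>) x - x) / \<epsilon>) \<longlongrightarrow> l) (at_right 0))"

text \<open>If both directions hold, then \<open>\<kappa> \<epsilon>\<close> is the identity on \<open>A\<close> for small \<open>\<epsilon>\<close>, \<open>stress_inv_rate\<close>
  vanishes on \<open>A\<close>, and the choice of sign is immaterial.\<close>

definition stress_sign :: "real set \<Rightarrow> (real \<Rightarrow> real \<Rightarrow> real) \<Rightarrow> real" where
  "stress_sign A \<kappa> = (if stress_up A \<kappa> then 1 else - 1)"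

definition stress_inv_rate :: "real set \<Rightarrow> (real \<Rightarrow> real \<Rightarrow> real) \<Rightarrow> real \<Rightarrow> real" where
  "stress_inv_rate A \<kappa> x = Lim (at_right 0) (\<lambda>\<epsilon>. (inv_into A (\<kappa> \<epsilon>) x - x) / \<epsilon>)"

definition gen_cdf :: "'a measure \<Rightarrow> ('a \<Rightarrow> real) \<Rightarrow> real \<Rightarrow> real \<Rightarrow> real" where
  "gen_cdf M X x l =
     measure M {\<omega>\<in>space M. X \<omega> < x} + l * measure M {\<omega>\<in>space M. X \<omega> = x}"

definition Delta :: "(real \<times> (real ^ 'd::finite) \<Rightarrow> real) \<Rightarrow> (nat \<Rightarrow> real) \<Rightarrow> nat \<Rightarrow> nat
    \<Rightarrow> real ^ 'd \<Rightarrow> real" where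
  "Delta h w r k y = (if k < r then h (w k, y) - h (w (Suc k), y) else h (w r, y))"

definition stressed_loss :: "(real \<times> (real ^ 'd::finite) \<Rightarrow> real) \<Rightarrow> (nat \<Rightarrow> real) \<Rightarrow> (nat \<Rightarrow> real)
    \<Rightarrow> nat \<Rightarrow> (real \<Rightarrow> real \<Rightarrow> real) \<Rightarrow> ('a \<Rightarrow> real) \<Rightarrow> ('a \<Rightarrow> real ^ 'd) \<Rightarrow> real \<Rightarrow> 'a \<Rightarrow> real" where
  "stressed_loss h w p r \<kappa> U Y \<epsilon> \<omega> =
     (\<Sum>k=1..r. Delta h w r k (Y \<omega>) * indicator {..p k} (\<kappa> \<epsilon> (U \<omega>)))"

text \<open>The atom from which mass moves when the threshold \<open>p k\<close> of the uniform variable \<open>U\<close> is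
  replaced by its preimage \<open>p'\<close> under \<open>\<kappa> \<epsilon>\<close>. If the sign is \<open>1\<close>, then \<open>p' \<le> p k\<close> and
  \<open>{p' < U \<le> p k}\<close> lies in \<open>{W = w k}\<close>; if it is \<open>-1\<close>, then \<open>p k \<le> p'\<close> and \<open>{p k < U \<le> p'}\<close> lies in
  \<open>{W = w (k + 1)}\<close>. For \<open>k = r\<close> no mass moves, since \<open>\<kappa> \<epsilon> 1 = 1\<close>.\<close>

definition source_index :: "real set \<Rightarrow> (real \<Rightarrow> real \<Rightarrow> real) \<Rightarrow> nat \<Rightarrow> nat \<Rightarrow> nat" where
  "source_index A \<kappa> r k = (if stress_sign A \<kappa> = 1 then k else min (Suc k) r)"

definition cond_expectation :: "'a measure \<Rightarrow> ('a \<Rightarrow> real) \<Rightarrow> 'a set \<Rightarrow> real" where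
  "cond_expectation M X E = (LINT \<omega>:E|M. X \<omega>) / measure M E"

definition quantile :: "(real \<Rightarrow> real) \<Rightarrow> real \<Rightarrow> real" where
  "quantile F u = Inf {y. F y \<ge> u}"

definition dist_fun :: "'a measure \<Rightarrow> ('a \<Rightarrow> real) \<Rightarrow> real \<Rightarrow> real" where
  "dist_fun M X = cdf (distr M borel X)"

definition VaR :: "'a measure \<Rightarrow> real \<Rightarrow> ('a \<Rightarrow> real) \<Rightarrow> real" where
  "VaR M \<alpha> X = quantile (dist_fun M X) \<alpha>"

definition ES :: "'a measure \<Rightarrow> real \<Rightarrow> ('a \<Rightarrow> real) \<Rightarrow> real" where
  "ES M \<alpha> X = 1 / (1 - \<alpha>) * (LINT u:{\<alpha><..<1}|lborel. quantile (dist_fun M X) u)"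

definition ES_finite :: "'a measure \<Rightarrow> real \<Rightarrow> ('a \<Rightarrow> real) \<Rightarrow> bool" where
  "ES_finite M \<alpha> X \<longleftrightarrow> set_integrable lborel {\<alpha><..<1} (quantile (dist_fun M X))"

definition C1_at :: "(real \<Rightarrow> real) \<Rightarrow> real \<Rightarrow> bool" where
  "C1_at F x \<longleftrightarrow>
     (\<exists>F'. (\<forall>\<^sub>F y in nhds x. (F has_real_derivative F' y) (at y)) \<and> isCont F' x)"

end

theory Submission
  imports Defs
begin

text \<open>Write \<open>s k\<close> for the preimage of \<open>p k\<close> under \<open>\<kappa> \<epsilon>\<close>. Stressing moves the thresholds of \<open>U\<close> from
  \<open>p k\<close> to \<open>s k\<close>; for small \<open>\<epsilon>\<close> this changes the loss from \<open>T\<close> to \<open>T - c \<Delta>\<^sub>k\<close> on an event that, given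
  \<open>(W, Y)\<close>, has probability \<open>\<bar>p k - s k\<bar> / P(W = w)\<close> on the atom \<open>{W = w}\<close> next to \<open>p k\<close>. Hence
  \<open>E \<phi>(T\<^sub>\<epsilon>) = E \<phi>(T) + (\<Sum>k. c (p k - s k) E[\<phi>(T - c \<Delta>\<^sub>k) - \<phi>(T) | W])\<close>, for every
  \<open>\<phi>\<close> with both sides integrable. With \<open>\<phi>\<close> the indicator of \<open>{..t}\<close> this expands the distribution
  function, and the quantile equation is differentiated at \<open>\<epsilon> = 0\<close>. With \<open>\<phi>(t) = max (t - x) 0\<close> it
  expands the Rockafellar-Uryasev objective \<open>x + E max (T\<^sub>\<epsilon> - x) 0 / (1 - \<alpha>)\<close>, whose minimum over
  \<open>x\<close> is the expected shortfall, attained at the quantile.\<close>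

subsection \<open>Perturbation of quantiles and minima\<close>

lemma near_zero_eventually: "near_zero P \<Longrightarrow> \<forall>\<^sub>F \<epsilon> in at_right 0. P \<epsilon>"
  unfolding near_zero_def eventually_at_right_field by (metis atLeastLessThan_iff less_imp_le)

lemma near_zero_at_zero: "near_zero P \<Longrightarrow> P 0"
  unfolding near_zero_def by auto

text \<open>Removing \<open>0\<close> from \<open>{0..}\<close> leaves \<open>{0<..}\<close>, so the
  one-sided derivative in the stress parameter is a right limit of difference quotients.\<close>

lemma has_real_derivative_at_zero_iff:
  fixes g :: "real \<Rightarrow> real"
  shows "(g has_real_derivative D) (at 0 within {0..}) \<longleftrightarrow>
    ((\<lambda>\<epsilon>. (g \<epsilon> - g 0) / \<epsilon>) \<longlongrightarrow> D) (at_right 0)"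
proof -
  have "at (0::real) within {0..} = at_right 0"
    by (auto simp: at_within_def intro!: arg_cong[where f = "\<lambda>S. inf _ (principal S)"])
  then show ?thesis
    by (simp add: has_field_derivative_iff)
qed

lemma C1_at_imp_isCont: "C1_at F x \<Longrightarrow> isCont F x"
  unfolding C1_at_def by (meson DERIV_isCont eventually_nhds_x_imp_x)

text \<open>The limits in \<open>n\<close> and in the argument are exchanged at the single point
  \<open>x\<close>; uniformity over the whole line replaces any neighbourhood of \<open>x\<close>
  common to all \<open>g n\<close>.\<close>

lemma isCont_uniform_limit:
  fixes g :: "'b \<Rightarrow> real \<Rightarrow> real"
  assumes "uniform_limit UNIV g l F" and "\<forall>\<^sub>F n in F. isCont (g n) x" and "F \<noteq> bot"
  shows "isCont l x"
proof -
  have "(l \<longlongrightarrow> l x) (at x)"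
  proof (rule swap_uniform_limit[OF _ _ _ assms(3)])
    show "\<forall>\<^sub>F n in F. (g n \<longlongrightarrow> g n x) (at x)"
      using assms(2) by (simp add: isCont_def)
    show "(( \<lambda>n. g n x) \<longlongrightarrow> l x) F"
      using assms(1) by (rule tendsto_uniform_limitI) simp
    show "uniform_limit UNIV g l F" by fact
  qed
  then show ?thesis by (simp add: isCont_def)
qed

text \<open>Only continuity of each perturbed function at the fixed point \<open>q\<close> is available; it passes to the
  uniform limit of the difference quotients, which may therefore be evaluated at the moving
  quantile.\<close>

lemma quantile_perturbation:
  fixes F :: "real \<Rightarrow> real" and G :: "'k \<Rightarrow> real \<Rightarrow> real" and b :: "'k \<Rightarrow> real \<Rightarrow> real"
  assumes F: "(F has_real_derivative D) (at (Q 0))" "F (Q 0) = \<alpha>"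
    and expansion: "\<forall>\<^sub>F \<epsilon> in at_right 0. \<forall>t. F\<^sub>\<epsilon> \<epsilon> t = F t + \<epsilon> * (\<Sum>k\<in>I. b k \<epsilon> * G k t)"
    and G_bound: "\<And>k t. k \<in> I \<Longrightarrow> \<bar>G k t\<bar> \<le> 1"
    and b: "\<And>k. k \<in> I \<Longrightarrow> (b k \<longlongrightarrow> B k) (at_right 0)"
    and cont: "\<forall>\<^sub>F \<epsilon> in at_right 0. isCont (F\<^sub>\<epsilon> \<epsilon>) (Q 0)"
    and Q: "(Q has_real_derivative Q') (at 0 within {0..})"
    and quantile: "\<forall>\<^sub>F \<epsilon> in at_right 0. \<alpha> \<le> F\<^sub>\<epsilon> \<epsilon> (Q \<epsilon>) \<and> (\<forall>y<Q \<epsilon>. F\<^sub>\<epsilon> \<epsilon> y < \<alpha>)"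
  shows "D * Q' = - (\<Sum>k\<in>I. B k * G k (Q 0))"
proof -
  define g where "g \<epsilon> t = (\<Sum>k\<in>I. b k \<epsilon> * G k t)" for \<epsilon> t
  define l where "l t = (\<Sum>k\<in>I. B k * G k t)" for t
  have pos: "\<forall>\<^sub>F \<epsilon> in at_right 0. 0 < (\<epsilon>::real)"
    by (rule eventually_at_right_less)
  \<comment> \<open>Since every \<open>G k\<close> is bounded by 1, the error is at most the sum of
    the errors of the coefficients, whatever \<open>t\<close> is.\<close>
  have lim: "uniform_limit UNIV g l (at_right 0)"
  proof (rule uniform_limitI)
    fix e :: real assume "0 < e"
    have "((\<lambda>\<epsilon>. \<Sum>k\<in>I. \<bar>b k \<epsilon> - B k\<bar>) \<longlongrightarrow> (\<Sum>k\<in>I. \<bar>B k - B k\<bar>)) (at_right 0)"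
      by (intro tendsto_intros b)
    then have "\<forall>\<^sub>F \<epsilon> in at_right 0. (\<Sum>k\<in>I. \<bar>b k \<epsilon> - B k\<bar>) < e"
      using \<open>0 < e\<close> by (auto dest: order_tendstoD(2))
    then show "\<forall>\<^sub>F \<epsilon> in at_right 0. \<forall>t\<in>UNIV. dist (g \<epsilon> t) (l t) < e"
    proof (eventually_elim, intro ballI)
      fix \<epsilon> t assume small: "(\<Sum>k\<in>I. \<bar>b k \<epsilon> - B k\<bar>) < e"
      have "\<bar>g \<epsilon> t - l t\<bar> = \<bar>\<Sum>k\<in>I. (b k \<epsilon> - B k) * G k t\<bar>"
        by (simp add: g_def l_def sum_subtractf left_diff_distrib)
      also have "\<dots> \<le> (\<Sum>k\<in>I. \<bar>(b k \<epsilon> - B k) * G k t\<bar>)"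
        by (rule sum_abs)
      also have "\<dots> \<le> (\<Sum>k\<in>I. \<bar>b k \<epsilon> - B k\<bar>)"
        by (intro sum_mono) (simp add: abs_mult mult_left_le G_bound)
      finally show "dist (g \<epsilon> t) (l t) < e"
        using small by (simp add: dist_real_def)
    qed
  qed
  \<comment> \<open>A single \<open>G k\<close> may jump at \<open>Q 0\<close>; it is the
    combination \<open>g \<epsilon>\<close>, a difference quotient of two functions continuous
    there, that is continuous.\<close>
  have "\<forall>\<^sub>F \<epsilon> in at_right 0. isCont (g \<epsilon>) (Q 0)"
    using expansion cont pos
  proof eventually_elim
    fix \<epsilon> :: real assume *: "\<forall>t. F\<^sub>\<epsilon> \<epsilon> t = F t + \<epsilon> * (\<Sum>k\<in>I. b k \<epsilon> * G k t)"
      "isCont (F\<^sub>\<epsilon> \<epsilon>) (Q 0)" "0 < \<epsilon>"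
    have "isCont (\<lambda>t. (F\<^sub>\<epsilon> \<epsilon> t - F t) / \<epsilon>) (Q 0)"
      using *(2,3) DERIV_isCont[OF F(1)] by (intro continuous_intros) auto
    moreover have "(\<lambda>t. (F\<^sub>\<epsilon> \<epsilon> t - F t) / \<epsilon>) = g \<epsilon>"
      using *(1,3) by (auto simp: g_def)
    ultimately show "isCont (g \<epsilon>) (Q 0)"
      by simp
  qed
  then have l_cont: "isCont l (Q 0)"
    by (rule isCont_uniform_limit[OF lim]) simp
  \<comment> \<open>The sum is
    \<open>F\<^sub>\<epsilon> \<epsilon> (R \<epsilon>) - \<alpha>\<close> divided by \<epsilon>. It
    is kept general in \<open>R\<close> because it is evaluated along the quantile and along a curve
    just below it with the same slope at \<open>0\<close>.\<close>
  have quotient: "((\<lambda>\<epsilon>. (F (R \<epsilon>) - \<alpha>) / \<epsilon> + g \<epsilon> (R \<epsilon>)) \<longlongrightarrow> D * Q' + l (Q 0)) (at_right 0)"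
    if R: "(R has_real_derivative Q') (at 0 within {0..})" "R 0 = Q 0" for R
  proof (rule tendsto_add)
    have "((F \<circ> R) has_real_derivative D * Q') (at 0 within {0..})"
      using F(1) R by (intro DERIV_chain) simp_all
    then show "((\<lambda>\<epsilon>. (F (R \<epsilon>) - \<alpha>) / \<epsilon>) \<longlongrightarrow> D * Q') (at_right 0)"
      using F(2) R(2) by (simp add: has_real_derivative_at_zero_iff)
    have "continuous (at 0 within {0..}) R"
      using R(1) by (rule DERIV_continuous)
    then have R_lim: "(R \<longlongrightarrow> Q 0) (at_right 0)"
      unfolding continuous_within R(2) by (rule tendsto_within_subset) auto
    have "((\<lambda>\<epsilon>. l (R \<epsilon>)) \<longlongrightarrow> l (Q 0)) (at_right 0)"
      using l_cont R_lim by (rule isCont_tendsto_compose)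
    moreover have "((\<lambda>\<epsilon>. g \<epsilon> (R \<epsilon>) - l (R \<epsilon>)) \<longlongrightarrow> 0) (at_right 0)"
    proof (rule tendstoI)
      fix e :: real assume "0 < e"
      from uniform_limitD[OF lim this]
      show "\<forall>\<^sub>F \<epsilon> in at_right 0. dist (g \<epsilon> (R \<epsilon>) - l (R \<epsilon>)) 0 < e"
        by eventually_elim (simp add: dist_real_def)
    qed
    ultimately show "((\<lambda>\<epsilon>. g \<epsilon> (R \<epsilon>)) \<longlongrightarrow> l (Q 0)) (at_right 0)"
      using tendsto_add by fastforce
  qed
  have "0 \<le> D * Q' + l (Q 0)"
  proof (rule tendsto_lowerbound[OF quotient[OF Q refl]])
    show "\<forall>\<^sub>F \<epsilon> in at_right 0. 0 \<le> (F (Q \<epsilon>) - \<alpha>) / \<epsilon> + g \<epsilon> (Q \<epsilon>)"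
      using expansion quantile pos
      by eventually_elim (auto simp: g_def field_simps)
  qed simp
  moreover have "D * Q' + l (Q 0) \<le> 0"
  \<comment> \<open>The perturbed function may exceed \<alpha> at its quantile
    \<open>Q \<epsilon>\<close>, so the upper bound is taken strictly below it; a shift of second
    order leaves the derivative at \<open>0\<close> unchanged.\<close>
  proof (rule tendsto_upperbound[OF quotient[of "\<lambda>\<epsilon>. Q \<epsilon> - \<epsilon> * \<epsilon>"]])
    show "((\<lambda>\<epsilon>. Q \<epsilon> - \<epsilon> * \<epsilon>) has_real_derivative Q') (at 0 within {0..})"
      using Q by (auto intro!: derivative_eq_intros)
    show "\<forall>\<^sub>F \<epsilon> in at_right 0.
        (F (Q \<epsilon> - \<epsilon> * \<epsilon>) - \<alpha>) / \<epsilon> + g \<epsilon> (Q \<epsilon> - \<epsilon> * \<epsilon>) \<le> 0"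
      using expansion quantile pos
    proof eventually_elim
      fix \<epsilon> :: real assume *: "\<forall>t. F\<^sub>\<epsilon> \<epsilon> t = F t + \<epsilon> * (\<Sum>k\<in>I. b k \<epsilon> * G k t)"
        "\<alpha> \<le> F\<^sub>\<epsilon> \<epsilon> (Q \<epsilon>) \<and> (\<forall>y<Q \<epsilon>. F\<^sub>\<epsilon> \<epsilon> y < \<alpha>)" "0 < \<epsilon>"
      then have "F\<^sub>\<epsilon> \<epsilon> (Q \<epsilon> - \<epsilon> * \<epsilon>) < \<alpha>"
        by simp
      then show "(F (Q \<epsilon> - \<epsilon> * \<epsilon>) - \<alpha>) / \<epsilon> + g \<epsilon> (Q \<epsilon> - \<epsilon> * \<epsilon>) \<le> 0"
        using * by (simp add: g_def field_simps)
    qed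
  qed simp_all
  ultimately show ?thesis
    by (simp add: l_def)
qed

text \<open>An envelope argument: the minimiser \<open>Q \<epsilon>\<close> of \<open>x + m \<epsilon> x / \<beta>\<close> moves, but \<open>Q 0\<close> and
  \<open>Q \<epsilon>\<close> give an upper and a lower bound for the increment.\<close>

lemma minimum_perturbation:
  fixes m :: "real \<Rightarrow> real" and H :: "'k \<Rightarrow> real \<Rightarrow> real" and b :: "'k \<Rightarrow> real \<Rightarrow> real"
  assumes expansion: "\<forall>\<^sub>F \<epsilon> in at_right 0. \<forall>x. m\<^sub>\<epsilon> \<epsilon> x = m x + \<epsilon> * (\<Sum>k\<in>I. b k \<epsilon> * H k x)"
    and H: "\<And>k. k \<in> I \<Longrightarrow> isCont (H k) (Q 0)"
    and b: "\<And>k. k \<in> I \<Longrightarrow> (b k \<longlongrightarrow> B k) (at_right 0)"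
    and Q: "(Q \<longlongrightarrow> Q 0) (at_right 0)"
    and \<beta>: "0 < \<beta>"
    and base: "\<And>x. E 0 \<le> x + m x / \<beta>" "E 0 = Q 0 + m (Q 0) / \<beta>"
    and min: "\<forall>\<^sub>F \<epsilon> in at_right 0. (\<forall>x. E \<epsilon> \<le> x + m\<^sub>\<epsilon> \<epsilon> x / \<beta>) \<and> E \<epsilon> = Q \<epsilon> + m\<^sub>\<epsilon> \<epsilon> (Q \<epsilon>) / \<beta>"
  shows "(E has_real_derivative (\<Sum>k\<in>I. B k * H k (Q 0)) / \<beta>) (at 0 within {0..})"
  unfolding has_real_derivative_at_zero_iff
proof (rule tendsto_sandwich)
  have pos: "\<forall>\<^sub>F \<epsilon> in at_right 0. 0 < (\<epsilon>::real)"
    by (rule eventually_at_right_less)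
  show "\<forall>\<^sub>F \<epsilon> in at_right 0. (\<Sum>k\<in>I. b k \<epsilon> * H k (Q \<epsilon>)) / \<beta> \<le> (E \<epsilon> - E 0) / \<epsilon>"
    using expansion min pos
  proof eventually_elim
    fix \<epsilon> :: real assume *: "\<forall>x. m\<^sub>\<epsilon> \<epsilon> x = m x + \<epsilon> * (\<Sum>k\<in>I. b k \<epsilon> * H k x)"
      "(\<forall>x. E \<epsilon> \<le> x + m\<^sub>\<epsilon> \<epsilon> x / \<beta>) \<and> E \<epsilon> = Q \<epsilon> + m\<^sub>\<epsilon> \<epsilon> (Q \<epsilon>) / \<beta>" "0 < \<epsilon>"
    have "E \<epsilon> - E 0 \<ge> \<epsilon> * (\<Sum>k\<in>I. b k \<epsilon> * H k (Q \<epsilon>)) / \<beta>"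
      using * base(1)[of "Q \<epsilon>"] by (simp add: add_divide_distrib)
    then show "(\<Sum>k\<in>I. b k \<epsilon> * H k (Q \<epsilon>)) / \<beta> \<le> (E \<epsilon> - E 0) / \<epsilon>"
      using *(3) by (simp add: pos_le_divide_eq mult.commute)
  qed
  show "\<forall>\<^sub>F \<epsilon> in at_right 0. (E \<epsilon> - E 0) / \<epsilon> \<le> (\<Sum>k\<in>I. b k \<epsilon> * H k (Q 0)) / \<beta>"
    using expansion min pos
  proof eventually_elim
    fix \<epsilon> :: real assume *: "\<forall>x. m\<^sub>\<epsilon> \<epsilon> x = m x + \<epsilon> * (\<Sum>k\<in>I. b k \<epsilon> * H k x)"
      "(\<forall>x. E \<epsilon> \<le> x + m\<^sub>\<epsilon> \<epsilon> x / \<beta>) \<and> E \<epsilon> = Q \<epsilon> + m\<^sub>\<epsilon> \<epsilon> (Q \<epsilon>) / \<beta>" "0 < \<epsilon>"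
    then have "E \<epsilon> \<le> Q 0 + m\<^sub>\<epsilon> \<epsilon> (Q 0) / \<beta>"
      by blast
    then have "E \<epsilon> - E 0 \<le> \<epsilon> * (\<Sum>k\<in>I. b k \<epsilon> * H k (Q 0)) / \<beta>"
      using *(1) base(2) by (simp add: add_divide_distrib)
    then show "(E \<epsilon> - E 0) / \<epsilon> \<le> (\<Sum>k\<in>I. b k \<epsilon> * H k (Q 0)) / \<beta>"
      using *(3) by (simp add: pos_divide_le_eq mult.commute)
  qed
  \<comment> \<open>Only the lower bound involves the moving point; continuity of \<open>H k\<close>
    at \<open>Q 0\<close> brings both bounds to the same limit.\<close>
  show "((\<lambda>\<epsilon>. (\<Sum>k\<in>I. b k \<epsilon> * H k (Q \<epsilon>)) / \<beta>) \<longlongrightarrow> (\<Sum>k\<in>I. B k * H k (Q 0)) / \<beta>) (at_right 0)"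
    using \<beta> by (intro tendsto_intros b isCont_tendsto_compose[OF H Q]) auto
  show "((\<lambda>\<epsilon>. (\<Sum>k\<in>I. b k \<epsilon> * H k (Q 0)) / \<beta>) \<longlongrightarrow> (\<Sum>k\<in>I. B k * H k (Q 0)) / \<beta>) (at_right 0)"
    using \<beta> by (intro tendsto_intros b) auto
qed

subsection \<open>Quantiles, expected shortfall and independence\<close>

context prob_space
begin

lemma indicator_atMost:
  assumes [measurable]: "X \<in> borel_measurable M"
  shows integrable_indicator_atMost: "integrable M (\<lambda>\<omega>. indicator {..t} (X \<omega>) :: real)"
    and expectation_indicator_atMost:
      "expectation (\<lambda>\<omega>. indicator {..t} (X \<omega>)) = dist_fun M X t"
proof -
  show "integrable M (\<lambda>\<omega>. indicator {..t} (X \<omega>) :: real)"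
    by (rule integrable_const_bound[where B = 1]) (auto simp: indicator_def)
  have "expectation (\<lambda>\<omega>. indicator {..t} (X \<omega>)) = expectation (indicator (X -` {..t} \<inter> space M))"
    by (rule Bochner_Integration.integral_cong) (auto simp: indicator_def)
  also have "\<dots> = dist_fun M X t"
    by (simp add: dist_fun_def cdf_def measure_distr)
  finally show "expectation (\<lambda>\<omega>. indicator {..t} (X \<omega>)) = dist_fun M X t" .
qed

text \<open>Galois connection between quantile and distribution function, from right continuity of
  the latter; for \<open>u\<close> strictly between 0 and 1 the set under the infimum is nonempty
  and bounded below.\<close>

lemma quantile_le_iff:
  assumes "X \<in> borel_measurable M" and "0 < u" "u < 1"
  shows "quantile (dist_fun M X) u \<le> x \<longleftrightarrow> u \<le> dist_fun M X x"
proof -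
  interpret D: cdf_distribution "distr M borel X"
    unfolding cdf_distribution_def using assms(1) by (rule real_distribution_distr)
  show ?thesis
    using D.pseudoinverse[of u x] assms(2,3) unfolding quantile_def dist_fun_def by simp
qed

text \<open>Quantile transform, as in the Skorohod construction; it carries expectations of
  functions of \<open>X\<close> to the unit interval, where the expected shortfall is
  defined.\<close>

lemma distr_quantile:
  assumes "X \<in> borel_measurable M"
  shows "quantile (dist_fun M X) \<in> borel_measurable (restrict_space lborel {0<..<1})"
    and "distr (restrict_space lborel {0<..<1}) borel (quantile (dist_fun M X)) = distr M borel X"
proof -
  interpret D: cdf_distribution "distr M borel X"
    unfolding cdf_distribution_def using assms(1) by (rule real_distribution_distr)
  have eq: "quantile (dist_fun M X) = (\<lambda>u. Inf {x. u \<le> D.C x})"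
    by (simp add: quantile_def dist_fun_def fun_eq_iff)
  show "distr (restrict_space lborel {0<..<1}) borel (quantile (dist_fun M X)) = distr M borel X"
    unfolding eq by (rule D.distr_I_eq_M)
  have "sets (restrict_space lborel {0<..<1::real}) = sets (restrict_space borel {0<..<1})"
    by (simp add: sets_restrict_space)
  from measurable_cong_sets[OF this refl]
  show "quantile (dist_fun M X) \<in> borel_measurable (restrict_space lborel {0<..<1})"
    unfolding eq using D.measurable_CI by blast
qed

text \<open>Both sides are integrals against the law of \<open>X\<close>. Integrability is stated as
  an equivalence because the excess of \<open>X\<close> over a level has to inherit it from the
  quantile function.\<close>

lemma expectation_quantile:
  fixes \<phi> :: "real \<Rightarrow> real"
  assumes [measurable]: "X \<in> borel_measurable M" "\<phi> \<in> borel_measurable borel"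
  shows "integrable M (\<lambda>\<omega>. \<phi> (X \<omega>)) \<longleftrightarrow>
      set_integrable lborel {0<..<1} (\<lambda>u. \<phi> (quantile (dist_fun M X) u))"
    and "expectation (\<lambda>\<omega>. \<phi> (X \<omega>)) = (LINT u:{0<..<1}|lborel. \<phi> (quantile (dist_fun M X) u))"
proof -
  let ?R = "restrict_space lborel {0<..<1::real}" and ?Q = "quantile (dist_fun M X)"
  note Q = distr_quantile[OF assms(1)]
  have "integrable M (\<lambda>\<omega>. \<phi> (X \<omega>)) \<longleftrightarrow> integrable (distr ?R borel ?Q) \<phi>"
    unfolding Q(2) by (simp add: integrable_distr_eq)
  also have "\<dots> \<longleftrightarrow> integrable ?R (\<lambda>u. \<phi> (?Q u))"
    using Q(1) by (simp add: integrable_distr_eq)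
  also have "\<dots> \<longleftrightarrow> set_integrable lborel {0<..<1} (\<lambda>u. \<phi> (?Q u))"
    by (simp add: integrable_restrict_space set_integrable_def)
  finally show "integrable M (\<lambda>\<omega>. \<phi> (X \<omega>)) \<longleftrightarrow> set_integrable lborel {0<..<1} (\<lambda>u. \<phi> (?Q u))" .
  have "expectation (\<lambda>\<omega>. \<phi> (X \<omega>)) = integral\<^sup>L (distr ?R borel ?Q) \<phi>"
    unfolding Q(2) by (simp add: integral_distr)
  also have "\<dots> = integral\<^sup>L ?R (\<lambda>u. \<phi> (?Q u))"
    using Q(1) by (simp add: integral_distr)
  also have "\<dots> = (LINT u:{0<..<1}|lborel. \<phi> (?Q u))"
    by (simp add: integral_restrict_space set_lebesgue_integral_def)
  finally show "expectation (\<lambda>\<omega>. \<phi> (X \<omega>)) = (LINT u:{0<..<1}|lborel. \<phi> (?Q u))" .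
qed

text \<open>Beyond \<alpha> the quantile function minus \<open>x\<close> is at most its positive
  part, which gives the bound. At the value at risk equality holds, since the quantile function is
  at most this value up to \<alpha> and at least this value beyond.\<close>

lemma ES_Rockafellar_Uryasev:
  assumes X[measurable]: "X \<in> borel_measurable M" and \<alpha>: "0 < \<alpha>" "\<alpha> < 1"
    and fin: "ES_finite M \<alpha> X"
  shows integrable_excess: "integrable M (\<lambda>\<omega>. max (X \<omega> - x) 0)"
    and ES_le: "ES M \<alpha> X \<le> x + expectation (\<lambda>\<omega>. max (X \<omega> - x) 0) / (1 - \<alpha>)"
    and ES_eq: "ES M \<alpha> X =
      VaR M \<alpha> X + expectation (\<lambda>\<omega>. max (X \<omega> - VaR M \<alpha> X) 0) / (1 - \<alpha>)"
proof -
  let ?Q = "quantile (dist_fun M X)"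
  define v where "v = VaR M \<alpha> X"
  have mono: "?Q u \<le> ?Q u'" if "0 < u" "u \<le> u'" "u' < 1" for u u'
    using quantile_le_iff[OF X, of u "?Q u'"] quantile_le_iff[OF X, of u' "?Q u'"] that by auto
  have low: "?Q u \<le> v" if "0 < u" "u \<le> \<alpha>" for u
    unfolding v_def VaR_def using mono that \<alpha> by auto
  have high: "v \<le> ?Q u" if "\<alpha> < u" "u < 1" for u
    unfolding v_def VaR_def using mono that \<alpha> by auto
  have Q_meas: "set_borel_measurable lborel {0<..<1} ?Q"
    using distr_quantile(1)[OF X]
    by (subst (asm) borel_measurable_restrict_space_iff) (auto simp: set_borel_measurable_def)
  have fin': "set_integrable lborel {\<alpha><..<1} ?Q"
    using fin by (simp add: ES_finite_def)
  have tail: "set_integrable lborel {\<alpha><..<1} (\<lambda>u. ?Q u - y)" for y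
    using fin' \<alpha> by (intro set_integral_diff) (auto simp: set_integrable_def)
  have tail_int: "(LINT u:{\<alpha><..<1}|lborel. ?Q u - y) = (1 - \<alpha>) * (ES M \<alpha> X - y)" for y
  proof -
    have "(LINT u:{\<alpha><..<1}|lborel. ?Q u - y) =
        (LINT u:{\<alpha><..<1}|lborel. ?Q u) - (LINT u:{\<alpha><..<1}|lborel. y)"
      using fin' \<alpha> by (intro set_integral_diff) (auto simp: set_integrable_def)
    moreover have "(LINT u:{\<alpha><..<1}|lborel. y) = (1 - \<alpha>) * y"
      using \<alpha> by (simp add: set_lebesgue_integral_def)
    moreover have "(LINT u:{\<alpha><..<1}|lborel. ?Q u) = (1 - \<alpha>) * ES M \<alpha> X"
      using \<alpha> by (simp add: ES_def)
    ultimately show ?thesis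
      by (simp add: right_diff_distrib)
  qed
  \<comment> \<open>Up to \<alpha> the excess is dominated by a constant; beyond \<alpha> it is the
    positive part of an integrable function.\<close>
  have excess: "set_integrable lborel {0<..<1} (\<lambda>u. max (?Q u - y) 0)" for y
  proof -
    have head: "set_integrable lborel {0<..\<alpha>} (\<lambda>u. max (?Q u - y) 0)"
      unfolding set_integrable_def
    proof (rule Bochner_Integration.integrable_bound)
      show "integrable lborel (\<lambda>u. indicator {0<..\<alpha>} u *\<^sub>R max (v - y) 0)"
        using \<alpha> by simp
      have [measurable]: "(\<lambda>u. indicator {0<..<1} u * ?Q u) \<in> borel_measurable borel"
        using Q_meas by (simp add: set_borel_measurable_def)
      \<comment> \<open>Measurability of \<open>?Q\<close> is known only on the open unit interval;
        multiplying by its indicator changes nothing on \<open>{0<..\<alpha>}\<close>, because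
        \<alpha> < 1.\<close>
      have "(\<lambda>u. indicator {0<..\<alpha>} u *\<^sub>R max (?Q u - y) 0) =
          (\<lambda>u. indicator {0<..\<alpha>} u *\<^sub>R max (indicator {0<..<1} u * ?Q u - y) 0)"
        using \<alpha> by (auto simp: indicator_def fun_eq_iff)
      then show "(\<lambda>u. indicator {0<..\<alpha>} u *\<^sub>R max (?Q u - y) 0) \<in> borel_measurable lborel"
        by simp
      show "AE u in lborel. norm (indicator {0<..\<alpha>} u *\<^sub>R max (?Q u - y) 0)
          \<le> norm (indicator {0<..\<alpha>} u *\<^sub>R max (v - y) 0)"
        using low by (intro AE_I2) (auto simp: indicator_def intro!: max.coboundedI1)
    qed
    have "set_integrable lborel {\<alpha><..<1} (\<lambda>u. max (?Q u - y) 0)"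
    proof -
      have "(\<lambda>u. indicator {\<alpha><..<1} u *\<^sub>R max (?Q u - y) 0) =
          (\<lambda>u. max (indicator {\<alpha><..<1} u *\<^sub>R (?Q u - y)) 0)"
        by (auto simp: indicator_def fun_eq_iff)
      then show ?thesis
        using tail[of y] unfolding set_integrable_def by simp
    qed
    with head have "set_integrable lborel ({0<..\<alpha>} \<union> {\<alpha><..<1}) (\<lambda>u. max (?Q u - y) 0)"
      by (rule set_integrable_Un) auto
    moreover have "{0<..\<alpha>} \<union> {\<alpha><..<1} = {0<..<1}"
      using \<alpha> by auto
    ultimately show ?thesis by simp
  qed
  have mean: "expectation (\<lambda>\<omega>. max (X \<omega> - y) 0) = (LINT u:{0<..<1}|lborel. max (?Q u - y) 0)" for y
    by (rule expectation_quantile(2)[OF X]) simp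
  show "integrable M (\<lambda>\<omega>. max (X \<omega> - x) 0)"
    using excess by (subst expectation_quantile(1)[OF X, of "\<lambda>t. max (t - x) 0"]) auto
  have "(LINT u:{\<alpha><..<1}|lborel. ?Q u - x) \<le> (LINT u:{0<..<1}|lborel. max (?Q u - x) 0)"
    using tail[of x] excess[of x] \<alpha>
    unfolding set_lebesgue_integral_def set_integrable_def
    by (intro integral_mono) (auto simp: indicator_def)
  then show "ES M \<alpha> X \<le> x + expectation (\<lambda>\<omega>. max (X \<omega> - x) 0) / (1 - \<alpha>)"
    using \<alpha> by (simp add: tail_int mean field_simps)
  have "(LINT u:{0<..<1}|lborel. max (?Q u - v) 0) = (LINT u:{\<alpha><..<1}|lborel. ?Q u - v)"
    unfolding set_lebesgue_integral_def
  proof (rule Bochner_Integration.integral_cong[OF refl])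
    fix u
    show "indicator {0<..<1} u *\<^sub>R max (?Q u - v) 0 = indicator {\<alpha><..<1} u *\<^sub>R (?Q u - v)"
      using low[of u] high[of u] \<alpha> by (cases "u \<le> \<alpha>") (auto simp: indicator_def)
  qed
  then have "expectation (\<lambda>\<omega>. max (X \<omega> - v) 0) = (1 - \<alpha>) * (ES M \<alpha> X - v)"
    by (simp add: tail_int mean)
  then show "ES M \<alpha> X = VaR M \<alpha> X + expectation (\<lambda>\<omega>. max (X \<omega> - VaR M \<alpha> X) 0) / (1 - \<alpha>)"
    using \<alpha> by (simp add: v_def)
qed

section \<open>Independence and expectations of products\<close>

text \<open>\<open>indep_var\<close> compares variables with values in one type, so independence of
  variables of different types is stated for the generated sigma-algebras. These contain the
  preimages under any measurable function of either variable.\<close>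

lemma indep_var_comp_indep_set:
  assumes ind: "indep_set (sets (vimage_algebra (space M) V S)) (sets (vimage_algebra (space M) Z N))"
    and [measurable]: "V \<in> measurable M S" "Z \<in> measurable M N" "f \<in> measurable S R" "g \<in> measurable N R"
  shows "indep_var R (\<lambda>\<omega>. f (V \<omega>)) R (\<lambda>\<omega>. g (Z \<omega>))"
proof -
  have sub: "sigma_sets (space M) {(\<lambda>\<omega>. k (B \<omega>)) -` A \<inter> space M |A. A \<in> sets R}
      \<subseteq> sets (vimage_algebra (space M) B Q)"
    if B: "B \<in> measurable M Q" and k: "k \<in> measurable Q R" for B Q k
  proof -
    have "(\<lambda>\<omega>. k (B \<omega>)) -` A \<inter> space M \<in> sets (vimage_algebra (space M) B Q)"
      if "A \<in> sets R" for A
    proof -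
      have "B -` (k -` A \<inter> space Q) \<inter> space M \<in> sets (vimage_algebra (space M) B Q)"
        using k that by (intro in_vimage_algebra measurable_sets)
      also have "B -` (k -` A \<inter> space Q) \<inter> space M = (\<lambda>\<omega>. k (B \<omega>)) -` A \<inter> space M"
        using measurable_space[OF B] by auto
      finally show ?thesis .
    qed
    then show ?thesis
      by (intro sets.sigma_sets_subset[of _ "vimage_algebra (space M) B Q", simplified]) auto
  qed
  show ?thesis
    unfolding indep_var_eq
  proof (intro conjI)
    show "random_variable R (\<lambda>\<omega>. f (V \<omega>))" "random_variable R (\<lambda>\<omega>. g (Z \<omega>))"
      by measurable
    show "indep_set (sigma_sets (space M) {(\<lambda>\<omega>. f (V \<omega>)) -` A \<inter> space M |A. A \<in> sets R})
        (sigma_sets (space M) {(\<lambda>\<omega>. g (Z \<omega>)) -` A \<inter> space M |A. A \<in> sets R})"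
      using ind sub[of V S f] sub[of Z N g] assms(2-5) unfolding indep_sets2_eq by blast
  qed
qed

text \<open>If \<open>G\<close> is not integrable, both sides are \<open>0\<close>: either \<open>X = 0\<close> a.e., or \<open>X * G\<close> is not
  integrable by Fubini.\<close>

lemma indep_var_expectation_mult:
  fixes X G :: "'a \<Rightarrow> real"
  assumes ind: "indep_var borel X borel G" and int_X: "integrable M X"
  shows "expectation (\<lambda>\<omega>. X \<omega> * G \<omega>) = expectation X * expectation G"
proof (cases "integrable M G")
  case True
  then show ?thesis
    by (rule indep_var_lebesgue_integral[OF ind int_X])
next
  case non: False
  have [measurable]: "random_variable borel X" "random_variable borel G"
    using ind by (auto dest: indep_var_rv1 indep_var_rv2)
  have "expectation (\<lambda>\<omega>. X \<omega> * G \<omega>) = 0"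
  proof (cases "integrable M (\<lambda>\<omega>. X \<omega> * G \<omega>)")
    case True
    interpret S: prob_space "distr M borel X" by (rule prob_space_distr) simp
    interpret N: prob_space "distr M borel G" by (rule prob_space_distr) simp
    interpret P: pair_prob_space "distr M borel X" "distr M borel G" ..
    have "integrable (distr M (borel \<Otimes>\<^sub>M borel) (\<lambda>\<omega>. (X \<omega>, G \<omega>))) (\<lambda>(x, z). x * z)"
      using True by (subst integrable_distr_eq) (auto simp: split_beta')
    then have "integrable (distr M borel X \<Otimes>\<^sub>M distr M borel G) (\<lambda>(x, z). x * z)"
      using ind unfolding indep_var_distribution_eq by simp
    then have "AE x in distr M borel X. integrable (distr M borel G) (\<lambda>z. x * z)"
      using P.AE_integrable_fst'[of "\<lambda>(x, z). x * z"] by simp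
    then have "AE x in distr M borel X. x = 0"
    proof eventually_elim
      fix x assume *: "integrable (distr M borel G) (\<lambda>z. x * z)"
      show "x = 0"
      proof (rule ccontr)
        assume "x \<noteq> 0"
        with * have "integrable (distr M borel G) (\<lambda>z. z)" by simp
        with non show False by (simp add: integrable_distr_eq)
      qed
    qed
    then have "AE \<omega> in M. X \<omega> * G \<omega> = 0"
      by (subst (asm) AE_distr_iff) auto
    then show ?thesis
      by (rule integral_eq_zero_AE)
  qed (rule not_integrable_integral_eq)
  with non show ?thesis
    by (simp add: not_integrable_integral_eq)
qed

end

subsection \<open>Discrete inputs with moved thresholds\<close>

text \<open>The last increment is \<open>h (w r, y)\<close> itself rather than a difference, so the
  telescope leaves no remainder at the upper end.\<close>

lemma Delta_telescope:
  assumes "1 \<le> m" "m \<le> r"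
  shows "(\<Sum>k=m..r. Delta h w r k y) = h (w m, y)"
  using assms(2,1)
proof (induction m rule: inc_induct)
  case base
  show ?case by (simp add: Delta_def)
next
  case (step n)
  then show ?case
    by (subst sum.atLeast_Suc_atMost) (simp_all add: Delta_def)
qed

text \<open>The terms below \<open>m\<close> vanish and the others are kept in full, which leaves a
  telescope starting at \<open>m\<close>.\<close>

lemma sum_Delta_threshold:
  fixes s :: "nat \<Rightarrow> real"
  assumes m: "1 \<le> m" "m \<le> r"
    and "\<And>k. 1 \<le> k \<Longrightarrow> k < m \<Longrightarrow> s k < u" and "\<And>k. m \<le> k \<Longrightarrow> k \<le> r \<Longrightarrow> u \<le> s k"
  shows "(\<Sum>k=1..r. Delta h w r k y * indicator {..s k} u) = h (w m, y)"
proof -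
  have "(\<Sum>k=1..r. Delta h w r k y * indicator {..s k} u) = (\<Sum>k=m..r. Delta h w r k y)"
  proof (intro sum.mono_neutral_cong_right ballI)
    fix k assume "k \<in> {1..r} - {m..r}"
    then have "s k < u" using assms(3) by auto
    then show "Delta h w r k y * indicator {..s k} u = 0" by (simp add: indicator_def)
  qed (use assms in auto)
  then show ?thesis
    using Delta_telescope[OF m] by simp
qed

text \<open>The model without the stress: the probabilistic computations are done for arbitrary
  thresholds close to \<open>p\<close>, and the stress function is substituted afterwards.\<close>

locale discrete_input = prob_space M for M :: "'a measure" +
  fixes W V :: "'a \<Rightarrow> real" and Y :: "'a \<Rightarrow> real ^ 'd::finite"
    and h :: "real \<times> (real ^ 'd) \<Rightarrow> real" and r :: nat and w p :: "nat \<Rightarrow> real"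
  assumes Y[measurable]: "Y \<in> borel_measurable M"
    and h[measurable]: "h \<in> borel_measurable borel"
    and W[measurable]: "W \<in> borel_measurable M"
    and w: "strict_mono_on {1..r} w"
    and W_values: "AE \<omega> in M. W \<omega> \<in> w ` {1..r}"
    and p_cdf: "\<And>k. k \<in> {1..r} \<Longrightarrow> p k = prob {\<omega>\<in>space M. W \<omega> \<le> w k}"
    and p: "p 0 = 0" "p r = 1" "strict_mono_on {0..r} p"
    and V[measurable]: "V \<in> borel_measurable M"
    and V_distr: "distr M borel V = uniform_measure lborel {0<..<1}"
    and V_indep: "indep_set (sets (vimage_algebra (space M) V borel))
      (sets (vimage_algebra (space M) (\<lambda>\<omega>. (W \<omega>, Y \<omega>)) borel))"
begin

definition U :: "'a \<Rightarrow> real" where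
  "U \<omega> = gen_cdf M W (W \<omega>) (V \<omega>)"

abbreviation T :: "'a \<Rightarrow> real" where
  "T \<omega> \<equiv> h (W \<omega>, Y \<omega>)"

text \<open>The stress acts on the thresholds instead of on \<open>U\<close>. With
  \<open>s k\<close> the preimage of \<open>p k\<close> this is the stressed loss almost
  surely.\<close>

definition threshold_loss :: "(nat \<Rightarrow> real) \<Rightarrow> 'a \<Rightarrow> real" where
  "threshold_loss s \<omega> = (\<Sum>k=1..r. Delta h w r k (Y \<omega>) * indicator {..s k} (U \<omega>))"

lemma p_less: "i < j \<Longrightarrow> j \<le> r \<Longrightarrow> p i < p j"
  using p(3) by (auto simp: strict_mono_on_def)

lemma p_le: "i \<le> j \<Longrightarrow> j \<le> r \<Longrightarrow> p i \<le> p j"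
  using p_less[of i j] by (cases "i = j") auto

lemma w_less_iff: "i \<in> {1..r} \<Longrightarrow> j \<in> {1..r} \<Longrightarrow> w i < w j \<longleftrightarrow> i < j"
  using w strict_mono_on_less by blast

lemma w_eq_iff: "i \<in> {1..r} \<Longrightarrow> j \<in> {1..r} \<Longrightarrow> w i = w j \<longleftrightarrow> i = j"
  using w_less_iff[of i j] w_less_iff[of j i] by force

section \<open>Law of the discrete input and of its uniform generator\<close>

text \<open>Indexing the atoms by \<open>Suc i\<close> lets \<open>p 0 = 0\<close> account for the
  lowest one, below which there is no mass.\<close>

lemma prob_W_less:
  assumes "i < r"
  shows "prob {\<omega>\<in>space M. W \<omega> < w (Suc i)} = p i"
proof (cases "i = 0")
  case True
  have "AE \<omega> in M. \<not> W \<omega> < w (Suc i)"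
    using W_values
  proof eventually_elim
    fix \<omega> assume "W \<omega> \<in> w ` {1..r}"
    then show "\<not> W \<omega> < w (Suc i)"
      using w_less_iff[of _ "Suc i"] True assms by auto
  qed
  then have "prob {\<omega>\<in>space M. W \<omega> < w (Suc i)} = 0"
    by (subst prob_eq_0) (auto elim: eventually_mono)
  with True p(1) show ?thesis by simp
next
  case False
  have "prob {\<omega>\<in>space M. W \<omega> < w (Suc i)} = prob {\<omega>\<in>space M. W \<omega> \<le> w i}"
  proof (rule finite_measure_eq_AE)
    show "AE \<omega> in M. (\<omega> \<in> {\<omega>\<in>space M. W \<omega> < w (Suc i)}) = (\<omega> \<in> {\<omega>\<in>space M. W \<omega> \<le> w i})"
      using W_values
    proof eventually_elim
      fix \<omega> assume "W \<omega> \<in> w ` {1..r}"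
      then obtain j where "W \<omega> = w j" "j \<in> {1..r}" by auto
      then show "(\<omega> \<in> {\<omega>\<in>space M. W \<omega> < w (Suc i)}) = (\<omega> \<in> {\<omega>\<in>space M. W \<omega> \<le> w i})"
        using False assms w_less_iff[of j "Suc i"] w_less_iff[of i j] by (auto simp: not_less[symmetric])
    qed
  qed measurable
  with p_cdf[of i] False assms show ?thesis by simp
qed

lemma prob_W_eq:
  assumes "i < r"
  shows "prob {\<omega>\<in>space M. W \<omega> = w (Suc i)} = p (Suc i) - p i"
proof -
  have "prob {\<omega>\<in>space M. W \<omega> \<le> w (Suc i)} =
      prob ({\<omega>\<in>space M. W \<omega> < w (Suc i)} \<union> {\<omega>\<in>space M. W \<omega> = w (Suc i)})"
    by (rule arg_cong[where f = prob]) auto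
  also have "\<dots> = prob {\<omega>\<in>space M. W \<omega> < w (Suc i)} + prob {\<omega>\<in>space M. W \<omega> = w (Suc i)}"
    by (rule finite_measure_Union) (measurable, auto)
  finally show ?thesis
    using prob_W_less[OF assms] p_cdf[of "Suc i"] assms by simp
qed

lemma prob_V:
  assumes "J \<in> sets borel"
  shows "prob {\<omega>\<in>space M. V \<omega> \<in> J} = measure lborel ({0<..<1} \<inter> J)"
proof -
  have "prob {\<omega>\<in>space M. V \<omega> \<in> J} = measure (distr M borel V) J"
    using assms by (subst measure_distr) (auto intro!: arg_cong[where f = prob])
  also have "\<dots> = measure lborel ({0<..<1} \<inter> J)"
    unfolding V_distr using assms by (subst measure_uniform_measure) auto
  finally show ?thesis .
qed

lemma AE_V: "AE \<omega> in M. 0 < V \<omega> \<and> V \<omega> < 1"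
proof -
  have "prob {\<omega>\<in>space M. V \<omega> \<in> {0<..<1}} = 1"
    by (subst prob_V) auto
  then have "AE \<omega> in M. \<omega> \<in> {\<omega>\<in>space M. V \<omega> \<in> {0<..<1}}"
    by (subst (asm) prob_eq_1) auto
  then show ?thesis
    by eventually_elim auto
qed

text \<open>On each atom \<open>U\<close> runs linearly through the jump of the distribution
  function of \<open>W\<close>, with \<open>V\<close> as the fraction covered; as \<open>V\<close>
  lies strictly inside the unit interval, \<open>U\<close> avoids every \<open>p k\<close> almost
  surely.\<close>

lemma AE_U:
  "AE \<omega> in M. \<exists>i<r. W \<omega> = w (Suc i) \<and> U \<omega> = p i + V \<omega> * (p (Suc i) - p i) \<and>
    p i < U \<omega> \<and> U \<omega> < p (Suc i)"
  using W_values AE_V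
proof eventually_elim
  fix \<omega> assume "W \<omega> \<in> w ` {1..r}" and V01: "0 < V \<omega> \<and> V \<omega> < 1"
  then obtain j where j: "W \<omega> = w j" "1 \<le> j" "j \<le> r" by auto
  then obtain i where i: "j = Suc i" "i < r" by (cases j) auto
  have U: "U \<omega> = p i + V \<omega> * (p (Suc i) - p i)"
    unfolding U_def gen_cdf_def j(1) i(1) by (simp add: prob_W_less prob_W_eq i(2))
  have pos: "0 < p (Suc i) - p i"
    using p_less[of i "Suc i"] i by simp
  have "0 < V \<omega> * (p (Suc i) - p i)" "V \<omega> * (p (Suc i) - p i) < 1 * (p (Suc i) - p i)"
    using V01 pos by (auto intro: mult_strict_right_mono)
  with U have "p i < U \<omega>" "U \<omega> < p (Suc i)" by auto
  with U i j show "\<exists>i<r. W \<omega> = w (Suc i) \<and> U \<omega> = p i + V \<omega> * (p (Suc i) - p i) \<and>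
    p i < U \<omega> \<and> U \<omega> < p (Suc i)" by blast
qed

section \<open>Thresholds moved within the adjacent atoms\<close>

text \<open>With \<open>c\<close> the stress sign this agrees with \<open>source_index\<close> for
  \<open>k < r\<close>. It is injective in \<open>k\<close>, so different thresholds take mass from
  different atoms.\<close>

definition src :: "real \<Rightarrow> nat \<Rightarrow> nat" where
  "src c k = (if c = 1 then k else Suc k)"

text \<open>The values of \<open>V\<close> for which \<open>U\<close> lies between \<open>s k\<close> and \<open>p k\<close>, given \<open>W = w (src c k)\<close>.\<close>

definition window :: "real \<Rightarrow> (nat \<Rightarrow> real) \<Rightarrow> nat \<Rightarrow> real set" where
  "window c s k =
    (if c = 1 then {v. s k < p (k - 1) + v * (p k - p (k - 1))}
     else {v. p k + v * (p (Suc k) - p k) \<le> s k})"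

text \<open>Each \<open>s k\<close> with \<open>k < r\<close> stays within the atom
  \<open>src c k\<close> adjacent to \<open>p k\<close>, and all move in the direction given by
  \<open>c\<close>. Hence every atom is cut by at most one moved threshold.\<close>

definition close_thresholds :: "real \<Rightarrow> (nat \<Rightarrow> real) \<Rightarrow> bool" where
  "close_thresholds c s \<longleftrightarrow> s r = 1 \<and>
    (c = 1 \<and> (\<forall>k\<in>{1..<r}. p (k - 1) < s k \<and> s k \<le> p k) \<or>
     c = -1 \<and> (\<forall>k\<in>{1..<r}. p k \<le> s k \<and> s k < p (Suc k)))"

text \<open>On the atom \<open>w (src c k)\<close> with \<open>k < r\<close> this is the loss at the
  neighbouring value of \<open>W\<close>: at \<open>w (Suc k)\<close> if \<open>c = 1\<close> and at
  \<open>w k\<close> if \<open>c = -1\<close>.\<close>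

definition shifted :: "real \<Rightarrow> nat \<Rightarrow> 'a \<Rightarrow> real" where
  "shifted c k \<omega> = T \<omega> - c * Delta h w r k (Y \<omega>)"

lemma window_sets [measurable]: "window c s k \<in> sets borel"
  unfolding window_def by (split if_split) (intro conjI impI; measurable)

lemma src_eq_iff: "src c k = src c l \<longleftrightarrow> k = l"
  by (simp add: src_def)

lemma src_range: "k \<in> {1..<r} \<Longrightarrow> src c k \<in> {1..r}"
  by (auto simp: src_def)

lemma Delta_measurable [measurable]: "Delta h w r k \<in> borel_measurable borel"
proof -
  have h': "h \<in> borel \<Otimes>\<^sub>M borel \<rightarrow>\<^sub>M borel"
    unfolding borel_prod by (rule h)
  have "(\<lambda>y. h (x, y)) \<in> borel_measurable borel" for x
    using measurable_compose[OF measurable_Pair1' h', of x] by simp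
  then show ?thesis
    unfolding Delta_def by simp
qed

lemma WY_measurable [measurable]: "(\<lambda>\<omega>. (W \<omega>, Y \<omega>)) \<in> borel_measurable M"
  by (rule borel_measurable_Pair) measurable

lemma T_measurable [measurable]: "T \<in> borel_measurable M"
  by (rule measurable_compose[OF WY_measurable h])

lemma shifted_measurable [measurable]: "shifted c k \<in> borel_measurable M"
  unfolding shifted_def by measurable

text \<open>Every atom is cut by at most one moved threshold, so at most one summand is nonzero; it
  passes to the neighbouring atom exactly when \<open>V\<close> lies in the window. One null set
  serves all \<open>\<phi>\<close>.\<close>

lemma threshold_loss_change:
  assumes s: "close_thresholds c s"
  shows "AE \<omega> in M. \<forall>\<phi> :: real \<Rightarrow> real. \<phi> (threshold_loss s \<omega>) = \<phi> (T \<omega>) +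
    (\<Sum>k=1..<r. indicator (window c s k) (V \<omega>) *
      (indicator {w (src c k)} (W \<omega>) * (\<phi> (shifted c k \<omega>) - \<phi> (T \<omega>))))"
  using AE_U
proof eventually_elim
  case (elim \<omega>)
  then obtain i where i: "i < r" and Wi: "W \<omega> = w (Suc i)"
    and u: "U \<omega> = p i + V \<omega> * (p (Suc i) - p i)" and ui: "p i < U \<omega>" "U \<omega> < p (Suc i)"
    by blast
  from s have sr: "s r = 1" and dir: "c = 1 \<or> c = -1"
    by (auto simp: close_thresholds_def)
  have loss: "threshold_loss s \<omega> = h (w m, Y \<omega>)"
    if "1 \<le> m" "m \<le> r" "\<And>k. 1 \<le> k \<Longrightarrow> k < m \<Longrightarrow> s k < U \<omega>" "\<And>k. m \<le> k \<Longrightarrow> k \<le> r \<Longrightarrow> U \<omega> \<le> s k" for m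
    unfolding threshold_loss_def using that by (rule sum_Delta_threshold)
  have u1: "U \<omega> \<le> 1"
    using ui p_le[of "Suc i" r] i p(2) by simp
  show ?case
  proof (intro allI)
    fix \<phi> :: "real \<Rightarrow> real"
    let ?d = "\<lambda>k. \<phi> (shifted c k \<omega>) - \<phi> (T \<omega>)"
    let ?S = "\<Sum>k=1..<r. indicator (window c s k) (V \<omega>) * (indicator {w (src c k)} (W \<omega>) * ?d k)"
    show "\<phi> (threshold_loss s \<omega>) = \<phi> (T \<omega>) + ?S"
      using dir
    proof
      assume c: "c = 1"
      have lo: "\<And>k. 1 \<le> k \<Longrightarrow> k < r \<Longrightarrow> p (k - 1) < s k" and hi: "\<And>k. 1 \<le> k \<Longrightarrow> k < r \<Longrightarrow> s k \<le> p k"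
        using s c by (auto simp: close_thresholds_def)
      have below: "s k < U \<omega>" if "1 \<le> k" "k \<le> i" for k
        using hi[of k] p_le[of k i] ui i that by linarith
      have above: "U \<omega> \<le> s k" if "Suc i < k" "k \<le> r" for k
      proof (cases "k = r")
        case False
        then show ?thesis
          using lo[of k] p_le[of "Suc i" "k - 1"] ui that by force
      qed (use sr u1 in simp)
      \<comment> \<open>Only \<open>k = Suc i\<close> uses the current atom. On the top atom,
        \<open>Suc i = r\<close>, this index is out of range and the sum is zero.\<close>
      have "?S = (\<Sum>k=1..<r. if k = Suc i then (if s (Suc i) < U \<omega> then ?d (Suc i) else 0) else 0)"
      proof (rule sum.cong[OF refl])
        fix k assume k: "k \<in> {1..<r}"
        then have "w k = w (Suc i) \<longleftrightarrow> k = Suc i"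
          using i by (intro w_eq_iff) auto
        then show "indicator (window c s k) (V \<omega>) * (indicator {w (src c k)} (W \<omega>) * ?d k) =
            (if k = Suc i then (if s (Suc i) < U \<omega> then ?d (Suc i) else 0) else 0)"
          using c by (auto simp: window_def src_def Wi u indicator_def)
      qed
      then have S: "?S = (if Suc i < r \<and> s (Suc i) < U \<omega> then ?d (Suc i) else 0)"
        by simp
      show ?thesis
      proof (cases "Suc i < r \<and> s (Suc i) < U \<omega>")
        case True
        have "threshold_loss s \<omega> = h (w (Suc (Suc i)), Y \<omega>)"
          using True below above by (intro loss) (auto simp: less_Suc_eq_le le_Suc_eq)
        also have "\<dots> = shifted c (Suc i) \<omega>"
          using True c by (simp add: shifted_def Delta_def Wi)
        finally show ?thesis
          unfolding S using True by simp
      next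
        case False
        then have "U \<omega> \<le> s (Suc i)"
          using i sr u1 by (cases "Suc i = r") auto
        then have "U \<omega> \<le> s k" if "Suc i \<le> k" "k \<le> r" for k
          using that above by (cases "k = Suc i") auto
        then have "threshold_loss s \<omega> = T \<omega>"
          using below i by (subst loss[of "Suc i"]) (auto simp: Wi)
        then show ?thesis
          using False by (simp only: S if_False add_0_right)
      qed
    next
      assume c: "c = -1"
      have lo: "\<And>k. 1 \<le> k \<Longrightarrow> k < r \<Longrightarrow> p k \<le> s k" and hi: "\<And>k. 1 \<le> k \<Longrightarrow> k < r \<Longrightarrow> s k < p (Suc k)"
        using s c by (auto simp: close_thresholds_def)
      have below: "s k < U \<omega>" if "1 \<le> k" "k < i" for k
        using hi[of k] p_le[of "Suc k" i] ui i that by linarith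
      have above: "U \<omega> \<le> s k" if "i < k" "k \<le> r" for k
      proof (cases "k = r")
        case False
        then show ?thesis
          using lo[of k] p_le[of "Suc i" k] ui that by force
      qed (use sr u1 in simp)
      \<comment> \<open>Here the current atom belongs to \<open>k = i\<close>, so the lowest atom,
        \<open>i = 0\<close>, loses no mass.\<close>
      have "?S = (\<Sum>k=1..<r. if k = i then (if U \<omega> \<le> s i then ?d i else 0) else 0)"
      proof (rule sum.cong[OF refl])
        fix k assume k: "k \<in> {1..<r}"
        then have "w (Suc k) = w (Suc i) \<longleftrightarrow> k = i"
          using i w_eq_iff[of "Suc k" "Suc i"] by auto
        then show "indicator (window c s k) (V \<omega>) * (indicator {w (src c k)} (W \<omega>) * ?d k) =
            (if k = i then (if U \<omega> \<le> s i then ?d i else 0) else 0)"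
          using c by (auto simp: window_def src_def Wi u indicator_def)
      qed
      then have S: "?S = (if 1 \<le> i \<and> U \<omega> \<le> s i then ?d i else 0)"
        using i by simp
      show ?thesis
      proof (cases "1 \<le> i \<and> U \<omega> \<le> s i")
        case True
        have "U \<omega> \<le> s k" if "i \<le> k" "k \<le> r" for k
          using that above True by (cases "k = i") auto
        then have "threshold_loss s \<omega> = h (w i, Y \<omega>)"
          using True below i by (intro loss) auto
        also have "\<dots> = shifted c i \<omega>"
          using True c i by (simp add: shifted_def Delta_def Wi)
        finally show ?thesis
          unfolding S using True by simp
      next
        case False
        then have "s k < U \<omega>" if "1 \<le> k" "k < Suc i" for k
          using that below by (cases "k = i") auto
        then have "threshold_loss s \<omega> = T \<omega>"
          using above i by (subst loss[of "Suc i"]) (auto simp: Wi)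
        then show ?thesis
          using False by (simp only: S if_False add_0_right)
      qed
    qed
  qed
qed

text \<open>Given the atom, \<open>U\<close> is uniform on an interval whose length is the mass of
  the atom, so the window has probability displacement over mass. The factor \<open>c\<close> makes
  the displacement nonnegative.\<close>

lemma prob_window:
  assumes s: "close_thresholds c s" and k: "k \<in> {1..<r}"
  shows "prob {\<omega>\<in>space M. V \<omega> \<in> window c s k} * prob {\<omega>\<in>space M. W \<omega> = w (src c k)} =
    c * (p k - s k)"
proof -
  from s have "c = 1 \<or> c = -1"
    by (auto simp: close_thresholds_def)
  then show ?thesis
  proof
    assume c: "c = 1"
    obtain i where i: "k = Suc i" using k by (cases k) auto
    \<comment> \<open>The value of \<open>V\<close> at which \<open>U\<close> reaches
      \<open>s k\<close> on this atom.\<close>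
    define x where "x = (s k - p i) / (p k - p i)"
    have pos: "0 < p k - p i"
      using p_less[of i k] i k by simp
    have "p (k - 1) < s k \<and> s k \<le> p k"
      using s c k unfolding close_thresholds_def by auto
    then have lo_hi: "p i < s k" "s k \<le> p k"
      using i by auto
    have x: "0 < x" "x \<le> 1"
      using pos lo_hi by (auto simp: x_def field_simps)
    have "s k < p i + v * (p k - p i) \<longleftrightarrow> x < v" for v
      unfolding x_def pos_divide_less_eq[OF pos] by linarith
    moreover have "window c s k = {v. s k < p i + v * (p k - p i)}"
      by (simp add: window_def c i)
    ultimately have "v \<in> window c s k \<longleftrightarrow> x < v" for v
      by simp
    then have "{0<..<1} \<inter> window c s k = {x<..<1}"
      using x(1) by (intro set_eqI) force
    then have "prob {\<omega>\<in>space M. V \<omega> \<in> window c s k} = 1 - x"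
      unfolding prob_V[OF window_sets] using x by simp
    moreover have "prob {\<omega>\<in>space M. W \<omega> = w (src c k)} = p k - p i"
      using k c i prob_W_eq[of i] by (simp add: src_def)
    moreover have "x * (p k - p i) = s k - p i"
      using pos by (simp add: x_def)
    ultimately show ?thesis
      using c by (simp add: left_diff_distrib)
  next
    assume c: "c = -1"
    define x where "x = (s k - p k) / (p (Suc k) - p k)"
    have pos: "0 < p (Suc k) - p k"
      using p_less[of k "Suc k"] k by simp
    have x: "0 \<le> x" "x < 1"
      using s c k pos by (auto simp: x_def close_thresholds_def field_simps)
    have "p k + v * (p (Suc k) - p k) \<le> s k \<longleftrightarrow> v \<le> x" for v
      unfolding x_def pos_le_divide_eq[OF pos] by linarith
    moreover have "window c s k = {v. p k + v * (p (Suc k) - p k) \<le> s k}"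
      by (simp add: window_def c)
    ultimately have "v \<in> window c s k \<longleftrightarrow> v \<le> x" for v
      by simp
    then have "{0<..<1} \<inter> window c s k = {0<..x}"
      using x(2) by (intro set_eqI) force
    then have "prob {\<omega>\<in>space M. V \<omega> \<in> window c s k} = x"
      unfolding prob_V[OF window_sets] using x by simp
    moreover have "prob {\<omega>\<in>space M. W \<omega> = w (src c k)} = p (Suc k) - p k"
      using k c prob_W_eq[of k] by (simp add: src_def)
    ultimately show ?thesis
      using c pos by (simp add: x_def)
  qed
qed

text \<open>Independence of \<open>V\<close> separates the window from \<open>(W, Y)\<close>. The
  remaining integral is atom mass times conditional expectation, and \<open>prob_window\<close>
  merges both probabilities into the displacement of the threshold.\<close>

lemma expectation_threshold_loss:
  fixes \<phi> :: "real \<Rightarrow> real"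
  assumes s: "close_thresholds c s" and X: "AE \<omega> in M. X \<omega> = threshold_loss s \<omega>"
    and \<phi>[measurable]: "\<phi> \<in> borel_measurable borel"
    and int_X: "integrable M (\<lambda>\<omega>. \<phi> (X \<omega>))" and int_T: "integrable M (\<lambda>\<omega>. \<phi> (T \<omega>))"
  shows "expectation (\<lambda>\<omega>. \<phi> (X \<omega>)) = expectation (\<lambda>\<omega>. \<phi> (T \<omega>)) +
    (\<Sum>k=1..<r. c * (p k - s k) *
      cond_expectation M (\<lambda>\<omega>. \<phi> (shifted c k \<omega>) - \<phi> (T \<omega>)) {\<omega>\<in>space M. W \<omega> = w (src c k)})"
proof -
  define g where "g k z = indicator {w (src c k)} (fst z) *
    (\<phi> (h z - c * Delta h w r k (snd z)) - \<phi> (h z))" for k z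
  define D where "D k \<omega> = indicator (window c s k) (V \<omega>) * g k (W \<omega>, Y \<omega>)" for k \<omega>
  define B where "B k \<omega> = (indicator (window c s k) (V \<omega>) * indicator {w (src c k)} (W \<omega>) :: real)" for k \<omega>
  have g_meas [measurable]: "g k \<in> borel_measurable borel" for k
  proof -
    have [measurable]: "h \<in> borel \<Otimes>\<^sub>M borel \<rightarrow>\<^sub>M borel"
      unfolding borel_prod by (rule h)
    show ?thesis
      unfolding g_def borel_prod[symmetric] by measurable
  qed
  have [measurable]: "B k \<in> borel_measurable M" for k
    unfolding B_def by measurable
  have change: "AE \<omega> in M. \<phi> (X \<omega>) = \<phi> (T \<omega>) + (\<Sum>k=1..<r. D k \<omega>)"
    using threshold_loss_change[OF s] X
    by eventually_elim (simp add: D_def g_def shifted_def)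
  have D_meas [measurable]: "D k \<in> borel_measurable M" for k
    unfolding D_def by measurable
  \<comment> \<open>The summands \<open>D l\<close> live on different atoms, so the bounded factor
    \<open>B k\<close> extracts \<open>D k\<close> from the integrable difference of
    \<open>\<phi> (X \<omega>)\<close> and \<open>\<phi> (T \<omega>)\<close>.\<close>
  have int_D: "integrable M (D k)" if k: "k \<in> {1..<r}" for k
  proof -
    have "integrable M (\<lambda>\<omega>. B k \<omega> * (\<phi> (X \<omega>) - \<phi> (T \<omega>)))"
    proof (rule Bochner_Integration.integrable_bound)
      show int: "integrable M (\<lambda>\<omega>. \<phi> (X \<omega>) - \<phi> (T \<omega>))"
        using int_X int_T by simp
      show "(\<lambda>\<omega>. B k \<omega> * (\<phi> (X \<omega>) - \<phi> (T \<omega>))) \<in> borel_measurable M"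
        using borel_measurable_integrable[OF int] by simp
      show "AE \<omega> in M. norm (B k \<omega> * (\<phi> (X \<omega>) - \<phi> (T \<omega>))) \<le> norm (\<phi> (X \<omega>) - \<phi> (T \<omega>))"
        by (intro AE_I2) (auto simp: B_def indicator_def)
    qed
    moreover have "AE \<omega> in M. B k \<omega> * (\<phi> (X \<omega>) - \<phi> (T \<omega>)) = D k \<omega>"
      using change
    proof eventually_elim
      fix \<omega> assume "\<phi> (X \<omega>) = \<phi> (T \<omega>) + (\<Sum>k=1..<r. D k \<omega>)"
      then have "B k \<omega> * (\<phi> (X \<omega>) - \<phi> (T \<omega>)) = (\<Sum>l=1..<r. B k \<omega> * D l \<omega>)"
        by (simp add: sum_distrib_left)
      also have "\<dots> = (\<Sum>l=1..<r. if l = k then D k \<omega> else 0)"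
      proof (rule sum.cong[OF refl])
        fix l assume "l \<in> {1..<r}"
        then have "w (src c l) = w (src c k) \<longleftrightarrow> l = k"
          using k src_range by (subst w_eq_iff) (auto simp: src_eq_iff)
        then show "B k \<omega> * D l \<omega> = (if l = k then D k \<omega> else 0)"
          by (auto simp: B_def D_def g_def indicator_def)
      qed
      also have "\<dots> = D k \<omega>"
        using k by simp
      finally show "B k \<omega> * (\<phi> (X \<omega>) - \<phi> (T \<omega>)) = D k \<omega>" .
    qed
    ultimately show ?thesis
      by (rule integrable_cong_AE_imp[OF _ D_meas])
  qed
  have mean_D: "expectation (D k) = c * (p k - s k) *
      cond_expectation M (\<lambda>\<omega>. \<phi> (shifted c k \<omega>) - \<phi> (T \<omega>)) {\<omega>\<in>space M. W \<omega> = w (src c k)}"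
    if k: "k \<in> {1..<r}" for k
  proof -
    let ?E = "{\<omega>\<in>space M. W \<omega> = w (src c k)}"
    obtain i where i: "src c k = Suc i" "i < r"
      using src_range[OF k, of c] by (cases "src c k") auto
    have pos: "0 < prob ?E"
      using prob_W_eq[of i] p_less[of i "Suc i"] i by simp
    \<comment> \<open>The factor \<open>g k (W \<omega>, Y \<omega>)\<close> may fail to be
      integrable when the window has probability zero; the product rule still holds then, both sides
      being zero.\<close>
    have "expectation (D k) = prob {\<omega>\<in>space M. V \<omega> \<in> window c s k} * expectation (\<lambda>\<omega>. g k (W \<omega>, Y \<omega>))"
    proof -
      let ?I = "\<lambda>\<omega>. indicator (window c s k) (V \<omega>) :: real"
      have "indep_var borel ?I borel (\<lambda>\<omega>. g k (W \<omega>, Y \<omega>))"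
        by (rule indep_var_comp_indep_set[OF V_indep]) measurable
      moreover have "integrable M ?I"
        by (rule integrable_const_bound[where B = 1]) (auto simp: indicator_def)
      moreover have "expectation ?I = prob {\<omega>\<in>space M. V \<omega> \<in> window c s k}"
      proof -
        have "expectation ?I = expectation (indicator {\<omega>\<in>space M. V \<omega> \<in> window c s k})"
          by (rule Bochner_Integration.integral_cong) (auto simp: indicator_def)
        then show ?thesis by simp
      qed
      ultimately show ?thesis
        unfolding D_def by (simp add: indep_var_expectation_mult)
    qed
    also have "expectation (\<lambda>\<omega>. g k (W \<omega>, Y \<omega>)) = (LINT \<omega>:?E|M. \<phi> (shifted c k \<omega>) - \<phi> (T \<omega>))"
      unfolding set_lebesgue_integral_def
      by (rule Bochner_Integration.integral_cong) (auto simp: g_def shifted_def indicator_def)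
    also have "\<dots> = prob ?E * cond_expectation M (\<lambda>\<omega>. \<phi> (shifted c k \<omega>) - \<phi> (T \<omega>)) ?E"
      using pos by (simp add: cond_expectation_def)
    finally show ?thesis
      by (simp only: prob_window[OF s k, symmetric] mult.assoc)
  qed
  have "expectation (\<lambda>\<omega>. \<phi> (X \<omega>)) = expectation (\<lambda>\<omega>. \<phi> (T \<omega>) + (\<Sum>k=1..<r. D k \<omega>))"
    using change borel_measurable_integrable[OF int_X] by (intro integral_cong_AE) auto
  also have "\<dots> = expectation (\<lambda>\<omega>. \<phi> (T \<omega>)) + (\<Sum>k=1..<r. expectation (D k))"
    using int_T int_D by (subst Bochner_Integration.integral_add) auto
  finally show ?thesis
    by (simp add: mean_D)
qed

end

subsection \<open>Stress functions\<close>

text \<open>An injective monotone map is strictly monotone, so its inverse preserves order; this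
  turns a condition on the stressed \<open>U\<close> into a threshold condition on
  \<open>U\<close>.\<close>

lemma inv_into_mono_bij:
  fixes \<kappa> :: "real \<Rightarrow> real"
  assumes bij: "bij_betw \<kappa> A A" and mono: "mono_on A \<kappa>" and x: "x \<in> A"
  shows inv_into_mem: "inv_into A \<kappa> x \<in> A"
    and \<kappa>_inv_into: "\<kappa> (inv_into A \<kappa> x) = x"
    and le_inv_into_iff: "u \<in> A \<Longrightarrow> \<kappa> u \<le> x \<longleftrightarrow> u \<le> inv_into A \<kappa> x"
proof -
  show mem: "inv_into A \<kappa> x \<in> A" and eq: "\<kappa> (inv_into A \<kappa> x) = x"
    using bij x by (auto simp: bij_betw_def inv_into_into f_inv_into_f)
  show "\<kappa> u \<le> x \<longleftrightarrow> u \<le> inv_into A \<kappa> x" if u: "u \<in> A"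
  proof
    assume le: "\<kappa> u \<le> x"
    show "u \<le> inv_into A \<kappa> x"
    proof (rule ccontr)
      assume "\<not> u \<le> inv_into A \<kappa> x"
      then have "x \<le> \<kappa> u"
        using mono_onD[OF mono mem u] eq by simp
      with le have "\<kappa> u = x" by simp
      then have "inv_into A \<kappa> x = u"
        using bij u by (auto simp: bij_betw_def intro: inv_into_f_eq)
      then show False using \<open>\<not> u \<le> inv_into A \<kappa> x\<close> by simp
    qed
  next
    assume "u \<le> inv_into A \<kappa> x"
    then show "\<kappa> u \<le> x"
      using mono_onD[OF mono u mem] eq by simp
  qed
qed

text \<open>The image of \<open>b\<close> is at most \<open>b\<close>, so \<open>b\<close> is at
  most its own preimage, which lies in the interval.\<close>

lemma inv_into_mono_bij_top:
  fixes \<kappa> :: "real \<Rightarrow> real"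
  assumes bij: "bij_betw \<kappa> {a..b} {a..b}" and mono: "mono_on {a..b} \<kappa>" and "a \<le> b"
  shows "inv_into {a..b} \<kappa> b = b"
  using le_inv_into_iff[OF bij mono, of b b] inv_into_mem[OF bij mono, of b]
    bij_betwE[OF bij] \<open>a \<le> b\<close> by fastforce

context discrete_input
begin

lemma p_in_unit: "k \<le> r \<Longrightarrow> p k \<in> {0..1}"
  using p_le[of 0 k] p_le[of k r] p by auto

lemma stressed_loss_eq_threshold_loss:
  assumes bij: "bij_betw (\<kappa> \<epsilon>) {0..1} {0..1}" and mono: "mono_on {0..1} (\<kappa> \<epsilon>)"
  shows "AE \<omega> in M. stressed_loss h w p r \<kappa> U Y \<epsilon> \<omega> =
    threshold_loss (\<lambda>k. inv_into {0..1} (\<kappa> \<epsilon>) (p k)) \<omega>"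
  using AE_U
proof eventually_elim
  case (elim \<omega>)
  then obtain i where "i < r" "p i < U \<omega>" "U \<omega> < p (Suc i)" by auto
  then have "U \<omega> \<in> {0..1}"
    using p_in_unit[of i] p_in_unit[of "Suc i"] by auto
  then have "\<kappa> \<epsilon> (U \<omega>) \<le> p k \<longleftrightarrow> U \<omega> \<le> inv_into {0..1} (\<kappa> \<epsilon>) (p k)" if "k \<in> {1..r}" for k
    using that p_in_unit[of k] by (intro le_inv_into_iff[OF bij mono]) auto
  then show ?case
    unfolding stressed_loss_def threshold_loss_def
    by (intro sum.cong refl) (simp add: indicator_def)
qed

text \<open>The preimages converge to the finitely many \<open>p k\<close>, whose gaps are positive,
  so eventually none leaves the adjacent atom. They move against the stress: if
  \<open>\<kappa> \<epsilon>\<close> raises points, preimages lie below.\<close>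

lemma eventually_close_thresholds:
  assumes \<kappa>: "stress_function {0..1} \<kappa>" and mono: "near_zero (\<lambda>\<epsilon>. mono_on {0..1} (\<kappa> \<epsilon>))"
  shows "\<forall>\<^sub>F \<epsilon> in at_right 0.
    close_thresholds (stress_sign {0..1} \<kappa>) (\<lambda>k. inv_into {0..1} (\<kappa> \<epsilon>) (p k))"
proof -
  define s where "s \<epsilon> k = inv_into {0..1} (\<kappa> \<epsilon>) (p k)" for \<epsilon> k
  have ev: "\<forall>\<^sub>F \<epsilon> in at_right 0. bij_betw (\<kappa> \<epsilon>) {0..1} {0..1} \<and> mono_on {0..1} (\<kappa> \<epsilon>)"
    using \<kappa> near_zero_eventually[OF mono]
    by (auto simp: stress_function_def dest!: near_zero_eventually intro: eventually_conj)
  have lim: "((\<lambda>\<epsilon>. s \<epsilon> k) \<longlongrightarrow> p k) (at_right 0)" if "k \<in> {1..<r}" for k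
    using \<kappa> p_in_unit[of k] that unfolding stress_function_def s_def by auto
  have top: "\<forall>\<^sub>F \<epsilon> in at_right 0. s \<epsilon> r = 1"
    using ev by eventually_elim (auto simp: s_def p(2) intro: inv_into_mono_bij_top)
  have "\<forall>\<^sub>F \<epsilon> in at_right 0. close_thresholds (stress_sign {0..1} \<kappa>) (s \<epsilon>)"
  proof (cases "stress_up {0..1} \<kappa>")
    case True
    have "\<forall>\<^sub>F \<epsilon> in at_right 0. \<forall>k\<in>{1..<r}. p (k - 1) < s \<epsilon> k"
      using lim p_less by (intro eventually_ball_finite ballI order_tendstoD(1)) auto
    moreover have "\<forall>\<^sub>F \<epsilon> in at_right 0. \<forall>k\<in>{1..<r}. s \<epsilon> k \<le> p k"
      using near_zero_eventually[OF True[unfolded stress_up_def]] ev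
    proof eventually_elim
      case (elim \<epsilon>)
      show ?case
      proof
        fix k assume "k \<in> {1..<r}"
        then have "p k \<in> {0..1}" using p_in_unit[of k] by auto
        then show "s \<epsilon> k \<le> p k"
          using elim inv_into_mem[of "\<kappa> \<epsilon>" "{0..1}" "p k"] \<kappa>_inv_into[of "\<kappa> \<epsilon>" "{0..1}" "p k"]
          unfolding s_def by force
      qed
    qed
    ultimately show ?thesis
      using top by eventually_elim (simp add: close_thresholds_def stress_sign_def True)
  next
    case False
    then have down: "stress_down {0..1} \<kappa>"
      using \<kappa> by (auto simp: stress_function_def)
    have "\<forall>\<^sub>F \<epsilon> in at_right 0. \<forall>k\<in>{1..<r}. s \<epsilon> k < p (Suc k)"
      using lim p_less by (intro eventually_ball_finite ballI order_tendstoD(2)) auto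
    moreover have "\<forall>\<^sub>F \<epsilon> in at_right 0. \<forall>k\<in>{1..<r}. p k \<le> s \<epsilon> k"
      using near_zero_eventually[OF down[unfolded stress_down_def]] ev
    proof eventually_elim
      case (elim \<epsilon>)
      show ?case
      proof
        fix k assume "k \<in> {1..<r}"
        then have "p k \<in> {0..1}" using p_in_unit[of k] by auto
        then show "p k \<le> s \<epsilon> k"
          using elim inv_into_mem[of "\<kappa> \<epsilon>" "{0..1}" "p k"] \<kappa>_inv_into[of "\<kappa> \<epsilon>" "{0..1}" "p k"]
          unfolding s_def by force
      qed
    qed
    ultimately show ?thesis
      using top by eventually_elim (simp add: close_thresholds_def stress_sign_def False)
  qed
  then show ?thesis by (simp add: s_def[abs_def])
qed

lemma stress_inv_rate_p:
  assumes \<kappa>: "stress_function {0..1} \<kappa>" and k: "k \<le> r"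
  shows "((\<lambda>\<epsilon>. (inv_into {0..1} (\<kappa> \<epsilon>) (p k) - p k) / \<epsilon>) \<longlongrightarrow> stress_inv_rate {0..1} \<kappa> (p k)) (at_right 0)"
proof -
  obtain l where "((\<lambda>\<epsilon>. (inv_into {0..1} (\<kappa> \<epsilon>) (p k) - p k) / \<epsilon>) \<longlongrightarrow> l) (at_right 0)"
    using \<kappa> p_in_unit[OF k] unfolding stress_function_def by blast
  then show ?thesis
    unfolding stress_inv_rate_def by (simp add: tendsto_Lim)
qed

text \<open>An increasing bijection fixes the upper end of the unit interval. Hence the summand
  \<open>k = r\<close> of both sensitivities vanishes.\<close>

lemma stress_inv_rate_top:
  assumes \<kappa>: "stress_function {0..1} \<kappa>" and mono: "near_zero (\<lambda>\<epsilon>. mono_on {0..1} (\<kappa> \<epsilon>))"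
  shows "stress_inv_rate {0..1} \<kappa> (p r) = 0"
proof -
  have "\<forall>\<^sub>F \<epsilon> in at_right 0. (inv_into {0..1} (\<kappa> \<epsilon>) (p r) - p r) / \<epsilon> = 0"
    using eventually_close_thresholds[OF assms]
    by eventually_elim (simp add: close_thresholds_def p(2))
  then have "((\<lambda>\<epsilon>. (inv_into {0..1} (\<kappa> \<epsilon>) (p r) - p r) / \<epsilon>) \<longlongrightarrow> 0) (at_right 0)"
    by (rule tendsto_eventually)
  then show ?thesis
    using stress_inv_rate_p[OF \<kappa>, of r] tendsto_unique[OF trivial_limit_at_right_real] by blast
qed

end

section \<open>Bounds for conditional expectations given an event\<close>

text \<open>A null event or a non-integrable \<open>X\<close> gives the default value
  \<open>0\<close>, so the bound persists in these degenerate cases.\<close>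

lemma (in prob_space) cond_expectation_le:
  assumes A: "A \<in> events" and c: "0 \<le> c" and X: "\<And>\<omega>. \<bar>X \<omega>\<bar> \<le> c"
  shows "\<bar>cond_expectation M X A\<bar> \<le> c"
proof (cases "prob A = 0 \<or> \<not> set_integrable M A X")
  case True
  then show ?thesis
    using c by (auto simp: cond_expectation_def set_lebesgue_integral_def set_integrable_def
        not_integrable_integral_eq)
next
  case False
  have "\<bar>LINT \<omega>:A|M. X \<omega>\<bar> \<le> (LINT \<omega>:A|M. \<bar>X \<omega>\<bar>)"
    using False set_integral_norm_bound[of M A X] by simp
  also have "\<dots> \<le> (LINT \<omega>:A|M. c)"
  proof (rule set_integral_mono)
    show "set_integrable M A (\<lambda>_. c)"
      using A by (auto simp: set_integrable_def emeasure_eq_measure)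
  qed (use False X in \<open>auto intro: set_integrable_abs\<close>)
  also have "\<dots> = c * prob A"
    using A by (simp add: set_lebesgue_integral_def)
  finally show ?thesis
    using False zero_less_measure_iff[of M A]
    by (simp add: cond_expectation_def abs_divide pos_divide_le_eq)
qed

text \<open>Integrability of \<open>X\<close> over \<open>A\<close> is equivalent to that of \<open>X'\<close>; if both fail, both conditional
  expectations are \<open>0\<close>.\<close>

lemma (in prob_space) cond_expectation_diff_le:
  assumes [measurable]: "A \<in> events" "X \<in> borel_measurable M" "X' \<in> borel_measurable M"
    and c: "0 \<le> c" and close: "\<And>\<omega>. \<bar>X \<omega> - X' \<omega>\<bar> \<le> c"
  shows "\<bar>cond_expectation M X A - cond_expectation M X' A\<bar> \<le> c"
proof -
  have D: "set_integrable M A (\<lambda>\<omega>. X \<omega> - X' \<omega>)"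
    unfolding set_integrable_def
    by (rule integrable_const_bound[where B = c]) (use close c in \<open>auto simp: indicator_def\<close>)
  have "cond_expectation M X A - cond_expectation M X' A = cond_expectation M (\<lambda>\<omega>. X \<omega> - X' \<omega>) A \<or>
    cond_expectation M X A = cond_expectation M X' A"
  proof (cases "set_integrable M A X'")
    case True
    then have "set_integrable M A X"
      using set_integral_add(1)[OF D True] by simp
    with True show ?thesis
      by (simp add: cond_expectation_def diff_divide_distrib)
  next
    case False
    then have "\<not> set_integrable M A X"
      using set_integral_diff(1)[of M A X "\<lambda>\<omega>. X \<omega> - X' \<omega>"] D by auto
    with False show ?thesis
      by (auto simp: cond_expectation_def set_lebesgue_integral_def set_integrable_def
          not_integrable_integral_eq)
  qed
  then show ?thesis
    using cond_expectation_le[OF assms(1) c close] c by auto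
qed

subsection \<open>Sensitivities\<close>

theorem theorem5:
  fixes M :: "'a measure" and W V U T :: "'a \<Rightarrow> real" and Y :: "'a \<Rightarrow> real ^ 'd::finite"
    and h :: "real \<times> (real ^ 'd) \<Rightarrow> real"
    and r :: nat and w p :: "nat \<Rightarrow> real"
    and \<kappa> :: "real \<Rightarrow> real \<Rightarrow> real" and T\<^sub>W :: "real \<Rightarrow> 'a \<Rightarrow> real"
    and \<alpha> q c :: real and f K :: "real \<Rightarrow> real"
  assumes "prob_space M"
    and Y: "Y \<in> borel_measurable M"
    and h: "h differentiable_on UNIV"
    and W: "W \<in> borel_measurable M"
    and w: "strict_mono_on {1..r} w"
    and W_values: "AE \<omega> in M. W \<omega> \<in> w ` {1..r}"
    and p_cdf: "\<And>k. k \<in> {1..r} \<Longrightarrow> p k = measure M {\<omega>\<in>space M. W \<omega> \<le> w k}"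
    and p: "p 0 = 0" "p r = 1" "strict_mono_on {0..r} p"
    and T: "T = (\<lambda>\<omega>. h (W \<omega>, Y \<omega>))"
    and V: "V \<in> borel_measurable M" "distr M borel V = uniform_measure lborel {0<..<1}"
    and V_indep: "prob_space.indep_set M (sets (vimage_algebra (space M) V borel))
      (sets (vimage_algebra (space M) (\<lambda>\<omega>. (W \<omega>, Y \<omega>)) borel))"
    and U: "U = (\<lambda>\<omega>. gen_cdf M W (W \<omega>) (V \<omega>))"
    and \<kappa>: "stress_function {0..1} \<kappa>"
    and \<kappa>_increasing: "near_zero (\<lambda>\<epsilon>. mono_on {0..1} (\<kappa> \<epsilon>))"
    and c: "c = stress_sign {0..1} \<kappa>"
    and K: "K = stress_inv_rate {0..1} \<kappa>"
    and T\<^sub>W: "T\<^sub>W = stressed_loss h w p r \<kappa> U Y"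
    and T\<^sub>W_measurable: "near_zero (\<lambda>\<epsilon>. T\<^sub>W \<epsilon> \<in> borel_measurable M)"
    and \<alpha>: "0 < \<alpha>" "\<alpha> < 1"
    and F\<^sub>0: "dist_fun M (T\<^sub>W 0) = dist_fun M T"
    and q: "q = VaR M \<alpha> T"
    and F_C1: "near_zero (\<lambda>\<epsilon>. C1_at (dist_fun M (T\<^sub>W \<epsilon>)) q)"
    and q_diff: "(\<lambda>\<epsilon>. VaR M \<alpha> (T\<^sub>W \<epsilon>)) differentiable (at 0 within {0..})"
    and f: "\<forall>\<^sub>F y in nhds q. (dist_fun M T has_real_derivative f y) (at y)"
  shows "(f q \<noteq> 0 \<longrightarrow>
      ((\<lambda>\<epsilon>. VaR M \<alpha> (T\<^sub>W \<epsilon>)) has_real_derivative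
        c / f q * (\<Sum>k=1..r. K (p k) *
          cond_expectation M
            (\<lambda>\<omega>. indicator {..q + c * Delta h w r k (Y \<omega>)} (T \<omega>) - indicator {..q} (T \<omega>))
            {\<omega>\<in>space M. W \<omega> = w (source_index {0..1} \<kappa> r k)}))
      (at 0 within {0..})) \<and>
    (near_zero (\<lambda>\<epsilon>. ES_finite M \<alpha> (T\<^sub>W \<epsilon>)) \<longrightarrow>
      ((\<lambda>\<epsilon>. ES M \<alpha> (T\<^sub>W \<epsilon>)) has_real_derivative
        - c / (1 - \<alpha>) * (\<Sum>k=1..r. K (p k) *
          cond_expectation M
            (\<lambda>\<omega>. max (T \<omega> - c * Delta h w r k (Y \<omega>) - q) 0 - max (T \<omega> - q) 0)
            {\<omega>\<in>space M. W \<omega> = w (source_index {0..1} \<kappa> r k)}))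
      (at 0 within {0..}))"
proof -
  interpret prob_space M by fact
  have h_meas: "h \<in> borel_measurable borel"
    using h by (intro borel_measurable_continuous_onI differentiable_imp_continuous_on)
  interpret D: discrete_input M W V Y h r w p
    by unfold_locales (fact Y h_meas W w W_values p_cdf p V V_indep)+
  have T_eq: "T = D.T" and U_eq: "U = D.U"
    by (simp_all add: T U D.U_def fun_eq_iff)
  note [measurable] = D.T_measurable[folded T_eq] W
  define s where "s \<epsilon> k = inv_into {0..1} (\<kappa> \<epsilon>) (p k)" for \<epsilon> k
  \<comment> \<open>Mass leaving the source atom at threshold \<open>k\<close>, per unit of
    stress.\<close>
  define b where "b k \<epsilon> = c * (p k - s \<epsilon> k) / \<epsilon>" for k \<epsilon>
  define S where "S k = D.shifted c k" for k
  define C where "C \<phi> k = cond_expectation M (\<lambda>\<omega>. \<phi> (S k \<omega>) - \<phi> (T \<omega>))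
    {\<omega>\<in>space M. W \<omega> = w (D.src c k)}" for \<phi> :: "real \<Rightarrow> real" and k
  have S_meas [measurable]: "S k \<in> borel_measurable M" for k
    unfolding S_def by measurable
  have b_lim: "(b k \<longlongrightarrow> - c * K (p k)) (at_right 0)" if "k \<in> {1..<r}" for k
  proof -
    have "((\<lambda>\<epsilon>. - c * ((s \<epsilon> k - p k) / \<epsilon>)) \<longlongrightarrow> - c * K (p k)) (at_right 0)"
      unfolding s_def K using that by (intro tendsto_mult_left D.stress_inv_rate_p[OF \<kappa>]) auto
    then show ?thesis
      by (simp add: b_def[abs_def] right_diff_distrib diff_divide_distrib)
  qed
  have meas: "\<forall>\<^sub>F \<epsilon> in at_right 0. T\<^sub>W \<epsilon> \<in> borel_measurable M"
    and meas0: "T\<^sub>W 0 \<in> borel_measurable M"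
    using near_zero_eventually[OF T\<^sub>W_measurable] near_zero_at_zero[OF T\<^sub>W_measurable] by auto
  have "near_zero (\<lambda>\<epsilon>. bij_betw (\<kappa> \<epsilon>) {0..1} {0..1})"
    using \<kappa> by (simp add: stress_function_def)
  then have "\<forall>\<^sub>F \<epsilon> in at_right 0. AE \<omega> in M. T\<^sub>W \<epsilon> \<omega> = D.threshold_loss (s \<epsilon>) \<omega>"
    using near_zero_eventually near_zero_eventually[OF \<kappa>_increasing] unfolding T\<^sub>W U_eq s_def[abs_def]
    by (fast elim: eventually_elim2 intro: D.stressed_loss_eq_threshold_loss)
  \<comment> \<open>Left general in \<open>\<phi>\<close>: indicators of half-lines give the
    distribution function, positive parts the shortfall objective.\<close>
  with D.eventually_close_thresholds[OF \<kappa> \<kappa>_increasing] eventually_at_right_less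
  have expansion: "\<forall>\<^sub>F \<epsilon> in at_right 0. \<forall>\<phi>. \<phi> \<in> borel_measurable borel \<longrightarrow>
      integrable M (\<lambda>\<omega>. \<phi> (T\<^sub>W \<epsilon> \<omega>)) \<longrightarrow> integrable M (\<lambda>\<omega>. \<phi> (T \<omega>)) \<longrightarrow>
      expectation (\<lambda>\<omega>. \<phi> (T\<^sub>W \<epsilon> \<omega>)) =
        expectation (\<lambda>\<omega>. \<phi> (T \<omega>)) + \<epsilon> * (\<Sum>k=1..<r. b k \<epsilon> * C \<phi> k)"
  proof eventually_elim
    case (elim \<epsilon>)
    show ?case
      using D.expectation_threshold_loss[OF elim(1)[folded c, folded s_def] elim(3)] elim(2)
      by (simp add: T_eq C_def S_def b_def sum_distrib_left mult.assoc)
  qed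
  \<comment> \<open>The rate vanishes at \<open>k = r\<close>, and below \<open>r\<close> the two
    descriptions of the source atom coincide.\<close>
  have sum_C: "(\<Sum>k=1..r. K (p k) * cond_expectation M (X k)
        {\<omega>\<in>space M. W \<omega> = w (source_index {0..1} \<kappa> r k)}) = (\<Sum>k=1..<r. K (p k) * C \<phi> k)"
    if X: "\<And>k. X k = (\<lambda>\<omega>. \<phi> (S k \<omega>) - \<phi> (T \<omega>))" for X \<phi>
  proof (rule sum.mono_neutral_cong_right)
    have "K (p r) = 0"
      unfolding K by (rule D.stress_inv_rate_top[OF \<kappa> \<kappa>_increasing])
    moreover have "k = r" if "k \<in> {1..r} - {1..<r}" for k
      using that by auto
    ultimately show "\<forall>k\<in>{1..r} - {1..<r}. K (p k) * cond_expectation M (X k)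
        {\<omega>\<in>space M. W \<omega> = w (source_index {0..1} \<kappa> r k)} = 0"
      by (metis mult_zero_left)
    fix k assume "k \<in> {1..<r}"
    then have "source_index {0..1} \<kappa> r k = D.src c k"
      by (auto simp: source_index_def D.src_def c)
    then show "K (p k) * cond_expectation M (X k)
        {\<omega>\<in>space M. W \<omega> = w (source_index {0..1} \<kappa> r k)} = K (p k) * C \<phi> k"
      by (simp add: C_def X)
  qed auto
  let ?Q = "\<lambda>\<epsilon>. VaR M \<alpha> (T\<^sub>W \<epsilon>)"
  have Q0: "?Q 0 = q"
    using F\<^sub>0 by (simp add: VaR_def q)
  obtain Q' where Q': "(?Q has_real_derivative Q') (at 0 within {0..})"
    using q_diff by (auto simp: real_differentiable_def)
  have VaR: "(?Q has_real_derivative c / f q * (\<Sum>k=1..<r. K (p k) * C (indicator {..q}) k)) (at 0 within {0..})"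
    if f_nz: "f q \<noteq> 0"
  proof -
    have F': "(dist_fun M T has_real_derivative f q) (at q)"
      using f by (rule eventually_nhds_x_imp_x)
    have below: "dist_fun M T y < \<alpha>" if "y < q" for y
      using quantile_le_iff[of T \<alpha> y] \<alpha> that by (simp add: q VaR_def)
    \<comment> \<open>A quantile gives only the reverse inequality; continuity at \<open>q\<close>
      carries the bound from the left of \<open>q\<close> to \<open>q\<close> itself.\<close>
    have "dist_fun M T q \<le> \<alpha>"
    proof (rule tendsto_upperbound)
      show "(dist_fun M T \<longlongrightarrow> dist_fun M T q) (at_left q)"
        using DERIV_isCont[OF F'] by (auto simp: isCont_def filterlim_at_split)
      show "\<forall>\<^sub>F y in at_left q. dist_fun M T y \<le> \<alpha>"
        using below by (auto simp: eventually_at_filter intro!: always_eventually less_imp_le)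
    qed simp
    moreover have "\<alpha> \<le> dist_fun M T q"
      using quantile_le_iff[of T \<alpha> q] \<alpha> by (simp add: q VaR_def)
    ultimately have Fq: "dist_fun M T q = \<alpha>"
      by simp
    have "f q * Q' = - (\<Sum>k=1..<r. - c * K (p k) * C (indicator {..?Q 0}) k)"
    proof (rule quantile_perturbation[where Q = ?Q and F\<^sub>\<epsilon> = "\<lambda>\<epsilon>. dist_fun M (T\<^sub>W \<epsilon>)"])
      show "(dist_fun M T has_real_derivative f q) (at (?Q 0))" "dist_fun M T (?Q 0) = \<alpha>"
        using F' Fq by (simp_all add: Q0)
      show "\<forall>\<^sub>F \<epsilon> in at_right 0. \<forall>t. dist_fun M (T\<^sub>W \<epsilon>) t =
          dist_fun M T t + \<epsilon> * (\<Sum>k=1..<r. b k \<epsilon> * C (indicator {..t}) k)"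
        using expansion meas
      proof eventually_elim
        case (elim \<epsilon>)
        have "T \<in> borel_measurable M" by measurable
        note T_ind = indicator_atMost[OF this] and T\<^sub>W_ind = indicator_atMost[OF elim(2)]
        show ?case
          using elim(1)[rule_format, of "indicator {..t}" for t] by (simp add: T_ind T\<^sub>W_ind)
      qed
      show "\<bar>C (indicator {..t}) k\<bar> \<le> 1" for k t
        unfolding C_def by (rule cond_expectation_le) (auto simp: indicator_def)
      show "\<forall>\<^sub>F \<epsilon> in at_right 0. isCont (dist_fun M (T\<^sub>W \<epsilon>)) (?Q 0)"
        unfolding Q0 using near_zero_eventually[OF F_C1] by eventually_elim (rule C1_at_imp_isCont)
      show "\<forall>\<^sub>F \<epsilon> in at_right 0. \<alpha> \<le> dist_fun M (T\<^sub>W \<epsilon>) (?Q \<epsilon>) \<and>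
          (\<forall>y<?Q \<epsilon>. dist_fun M (T\<^sub>W \<epsilon>) y < \<alpha>)"
        using meas
      proof eventually_elim
        case (elim \<epsilon>)
        note iff = quantile_le_iff[OF elim \<alpha>, folded VaR_def]
        show ?case
          using iff[of "?Q \<epsilon>"] iff by (auto simp: not_le[symmetric])
      qed
    qed (fact Q' b_lim)+
    then have "f q * Q' = c * (\<Sum>k=1..<r. K (p k) * C (indicator {..q}) k)"
      by (simp add: Q0 sum_negf sum_distrib_left mult.assoc)
    then have "Q' = c / f q * (\<Sum>k=1..<r. K (p k) * C (indicator {..q}) k)"
      using f_nz by (simp add: nonzero_eq_divide_eq mult.commute)
    with Q' show ?thesis by simp
  qed
  have ES: "((\<lambda>\<epsilon>. ES M \<alpha> (T\<^sub>W \<epsilon>)) has_real_derivative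
      - c / (1 - \<alpha>) * (\<Sum>k=1..<r. K (p k) * C (\<lambda>t. max (t - q) 0) k)) (at 0 within {0..})"
    if fin: "near_zero (\<lambda>\<epsilon>. ES_finite M \<alpha> (T\<^sub>W \<epsilon>))"
  proof -
    let ?m = "\<lambda>X x. expectation (\<lambda>\<omega>. max (X \<omega> - x) 0)"
    \<comment> \<open>The neighbourhood contains \<open>0\<close>, and \<open>T\<close> has the same
      distribution function as \<open>T\<^sub>W 0\<close>.\<close>
    have "ES_finite M \<alpha> (T\<^sub>W 0)"
      using fin by (rule near_zero_at_zero)
    then have finT: "ES_finite M \<alpha> T"
      using F\<^sub>0 by (simp add: ES_finite_def)
    have ES0: "ES M \<alpha> (T\<^sub>W 0) = ES M \<alpha> T"
      using F\<^sub>0 by (simp add: ES_def)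
    have T_meas: "T \<in> borel_measurable M" by measurable
    note RU = ES_Rockafellar_Uryasev[OF _ \<alpha>]
    have "((\<lambda>\<epsilon>. ES M \<alpha> (T\<^sub>W \<epsilon>)) has_real_derivative
      (\<Sum>k=1..<r. - c * K (p k) * C (\<lambda>t. max (t - ?Q 0) 0) k) / (1 - \<alpha>)) (at 0 within {0..})"
    proof (rule minimum_perturbation[where Q = ?Q and m = "?m T" and m\<^sub>\<epsilon> = "\<lambda>\<epsilon>. ?m (T\<^sub>W \<epsilon>)"])
      show "\<forall>\<^sub>F \<epsilon> in at_right 0. \<forall>x. ?m (T\<^sub>W \<epsilon>) x =
          ?m T x + \<epsilon> * (\<Sum>k=1..<r. b k \<epsilon> * C (\<lambda>t. max (t - x) 0) k)"
        using expansion meas near_zero_eventually[OF fin]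
      proof eventually_elim
        case (elim \<epsilon>)
        show ?case
          using elim(1)[rule_format, of "\<lambda>t. max (t - x) 0" for x]
            RU(1)[OF elim(2,3)] RU(1)[OF T_meas finT] by simp
      qed
      show "isCont (\<lambda>x. C (\<lambda>t. max (t - x) 0) k) (?Q 0)" for k
      proof (rule lipschitz_on_continuous_within)
        \<comment> \<open>Two positive parts, each 1-Lipschitz in the level, give the constant
          2.\<close>
        show "2-lipschitz_on UNIV (\<lambda>x. C (\<lambda>t. max (t - x) 0) k)"
        proof (rule lipschitz_onI)
          fix x y :: real
          show "dist (C (\<lambda>t. max (t - x) 0) k) (C (\<lambda>t. max (t - y) 0) k) \<le> 2 * dist x y"
            unfolding C_def dist_real_def
          proof (rule cond_expectation_diff_le)
            fix \<omega>
            have add: "\<bar>(a - b) - (a' - b')\<bar> \<le> 2 * d"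
              if "\<bar>a - a'\<bar> \<le> d" "\<bar>b - b'\<bar> \<le> d" for a b a' b' d :: real
              using that by linarith
            have lip: "\<bar>max (a - x) 0 - max (a - y) 0\<bar> \<le> \<bar>x - y\<bar>" for a :: real
              by (simp add: max_def abs_minus_commute)
            show "\<bar>max (S k \<omega> - x) 0 - max (T \<omega> - x) 0 - (max (S k \<omega> - y) 0 - max (T \<omega> - y) 0)\<bar>
                \<le> 2 * \<bar>x - y\<bar>"
              by (rule add[OF lip lip])
          qed auto
        qed simp
      qed simp
      have "continuous (at 0 within {0..}) ?Q"
        using Q' by (rule DERIV_continuous)
      then show "(?Q \<longlongrightarrow> ?Q 0) (at_right 0)"
        unfolding continuous_within by (rule tendsto_within_subset) auto
      show "ES M \<alpha> (T\<^sub>W 0) \<le> x + ?m T x / (1 - \<alpha>)" for x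
        unfolding ES0 by (rule RU(2)[OF T_meas finT])
      show "ES M \<alpha> (T\<^sub>W 0) = ?Q 0 + ?m T (?Q 0) / (1 - \<alpha>)"
        unfolding ES0 Q0 q by (rule RU(3)[OF T_meas finT])
      show "\<forall>\<^sub>F \<epsilon> in at_right 0. (\<forall>x. ES M \<alpha> (T\<^sub>W \<epsilon>) \<le> x + ?m (T\<^sub>W \<epsilon>) x / (1 - \<alpha>)) \<and>
          ES M \<alpha> (T\<^sub>W \<epsilon>) = ?Q \<epsilon> + ?m (T\<^sub>W \<epsilon>) (?Q \<epsilon>) / (1 - \<alpha>)"
        using meas near_zero_eventually[OF fin]
        by eventually_elim (use RU in blast)
    qed (use \<alpha> b_lim in auto)
    moreover have "(\<Sum>k=1..<r. - c * K (p k) * C (\<lambda>t. max (t - ?Q 0) 0) k) / (1 - \<alpha>) =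
        - c / (1 - \<alpha>) * (\<Sum>k=1..<r. K (p k) * C (\<lambda>t. max (t - q) 0) k)"
      by (simp add: Q0 sum_negf sum_distrib_left sum_divide_distrib mult.assoc)
    ultimately show ?thesis by simp
  qed
  \<comment> \<open>Subtracting the increment from \<open>T\<close> instead of adding it to the
    level gives both formulas the common form
    \<open>\<phi> (S k \<omega>) - \<phi> (T \<omega>)\<close>.\<close>
  have ind: "(\<lambda>\<omega>. indicator {..q + c * Delta h w r k (Y \<omega>)} (T \<omega>) - indicator {..q} (T \<omega>)) =
      (\<lambda>\<omega>. indicator {..q} (S k \<omega>) - indicator {..q} (T \<omega>) :: real)" for k
    by (auto simp: S_def D.shifted_def T_eq indicator_def fun_eq_iff)
  have pos_part: "(\<lambda>\<omega>. max (T \<omega> - c * Delta h w r k (Y \<omega>) - q) 0 - max (T \<omega> - q) 0) =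
      (\<lambda>\<omega>. max (S k \<omega> - q) 0 - max (T \<omega> - q) 0)" for k
    by (simp add: S_def D.shifted_def T_eq)
  show ?thesis
    using VaR ES unfolding sum_C[OF ind] sum_C[OF pos_part] by blast
qed

end
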